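(* Counting on $n$ input bits, i.e. some operator mapping $|x\rangle|0^m\rangle\mapsto|x\rangle|\,|x|\,\rangle$ for all $x\in\{0,1\}^n$, where $m=\lceil\log_2(n+1)\rceil$ and $|x|$ is the Hamming weight of $x$ written in binary, can be approximated with polynomially small error by quantum circuits with fan-out of constant depth and size $O(n\log n)$.
   Context: A quantum circuit is a sequence of layers of quantum gates; gates in one layer act on disjoint qubits. The size of a gate is the number of qubits it acts on, the depth of a circuit is its number of layers, and its size is the total size of its gates. A circuit may use ancilla qubits initialised to $|0\rangle$. The (unbounded) fan-out gate maps $|y_1\rangle\cdots|y_k\rangle|x\rangle\mapsto|y_1\oplus x\rangle\cdots|y_k\oplus x\rangle|x\rangle$, for any $k$, and counts as one gate. A quantum circuit with fan-out uses one-qubit gates, controlled-not gates and fan-out gates; here arbitrary one-qubit gates are allowed. A circuit approximates an operator $V$ with error $\varepsilon$ if for every input state $|\psi\rangle$ in the domain of $V$ the state it produces from $|\psi\rangle|0\cdots0\rangle$ is within Euclidean distance $\varepsilon$ of $(V|\psi\rangle)|0\cdots0\rangle$ (ancillas restored). Polynomially small error means that for every constant $c>0$ there is such a family with error at most $n^{-c}$ (the depth and size constants may depend on $c$). *)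

theory Defs
  imports "HOL-Analysis.L2_Norm" "HOL-Library.Landau_Symbols"
begin

section \<open>States of qubit registers\<close>

text \<open>
  A vector in the state space of \<open>N\<close> qubits is given by its amplitudes in the computational
  basis, which is indexed by the bit strings of length \<open>N\<close>; \<open>x ! q\<close> is the value of qubit \<open>q\<close>.
  Amplitudes at strings of any other length are zero.
\<close>

type_synonym qvec = "bool list \<Rightarrow> complex"

definition bitstrings :: "nat \<Rightarrow> bool list set" where
  "bitstrings N = {x. length x = N}"

definition qspace :: "nat \<Rightarrow> qvec set" where
  "qspace N = {\<psi>. \<forall>x. x \<notin> bitstrings N \<longrightarrow> \<psi> x = 0}"

definition qnorm :: "nat \<Rightarrow> qvec \<Rightarrow> real" where
  "qnorm N \<psi> = L2_set (\<lambda>x. cmod (\<psi> x)) (bitstrings N)"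

definition ket :: "bool list \<Rightarrow> qvec" where
  "ket x = (\<lambda>y. of_bool (y = x))"

abbreviation zeros :: "nat \<Rightarrow> bool list" where
  "zeros k \<equiv> replicate k False"

text \<open>The product of a \<open>k\<close>-qubit vector with \<open>a\<close> ancilla qubits in the all-zero state.\<close>

definition with_zeros :: "nat \<Rightarrow> nat \<Rightarrow> qvec \<Rightarrow> qvec" where
  "with_zeros k a \<psi> = (\<lambda>z. \<psi> (take k z) * ket (zeros a) (drop k z))"


section \<open>Circuits with fan-out\<close>

text \<open>
  In \<open>OneQubit u q\<close>, \<open>u i j\<close> is the matrix entry in row \<open>i\<close> and column \<open>j\<close>. In \<open>CNot s t\<close> and
  \<open>FanOut s T\<close> the control (source) qubit is \<open>s\<close>. The fan-out gate is symmetric in its targets,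
  so these are given as a set.
\<close>

datatype gate =
    OneQubit "bool \<Rightarrow> bool \<Rightarrow> complex" nat
  | CNot nat nat
  | FanOut nat "nat set"

definition unitary2 :: "(bool \<Rightarrow> bool \<Rightarrow> complex) \<Rightarrow> bool" where
  "unitary2 u \<longleftrightarrow> (\<forall>i j. (\<Sum>k\<in>UNIV. cnj (u k i) * u k j) = of_bool (i = j))"

fun gate_qubits :: "gate \<Rightarrow> nat set" where
  "gate_qubits (OneQubit u q) = {q}"
| "gate_qubits (CNot s t) = {s, t}"
| "gate_qubits (FanOut s T) = insert s T"

fun proper_gate :: "gate \<Rightarrow> bool" where
  "proper_gate (OneQubit u q) \<longleftrightarrow> unitary2 u"
| "proper_gate (CNot s t) \<longleftrightarrow> s \<noteq> t"
| "proper_gate (FanOut s T) \<longleftrightarrow> s \<notin> T"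

definition gate_size :: "gate \<Rightarrow> nat" where
  "gate_size g = card (gate_qubits g)"

text \<open>Each bit whose index lies in \<open>T\<close> is replaced by its exclusive or with bit \<open>s\<close>.\<close>

definition xor_bits :: "nat \<Rightarrow> nat set \<Rightarrow> bool list \<Rightarrow> bool list" where
  "xor_bits s T x = map (\<lambda>i. if i \<in> T then x ! i \<noteq> x ! s else x ! i) [0..<length x]"

text \<open>The linear operator on \<open>N\<close> qubits that maps every basis vector \<open>ket x\<close> to \<open>ket (f x)\<close>.\<close>

definition basis_map :: "nat \<Rightarrow> (bool list \<Rightarrow> bool list) \<Rightarrow> qvec \<Rightarrow> qvec" where
  "basis_map N f \<psi> = (\<lambda>y. \<Sum>x | x \<in> bitstrings N \<and> f x = y. \<psi> x)"

fun apply_gate :: "nat \<Rightarrow> gate \<Rightarrow> qvec \<Rightarrow> qvec" where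
  "apply_gate N (OneQubit u q) \<psi> = (\<lambda>y. \<Sum>b\<in>UNIV. u (y ! q) b * \<psi> (y[q := b]))"
| "apply_gate N (CNot s t) \<psi> = basis_map N (xor_bits s {t}) \<psi>"
| "apply_gate N (FanOut s T) \<psi> = basis_map N (xor_bits s T) \<psi>"

text \<open>
  A circuit is a list of layers, the first one being applied first. The gates of a layer act on
  disjoint sets of qubits, so the order in which a layer lists them is immaterial.
\<close>

type_synonym layer = "gate list"
type_synonym circuit = "layer list"

definition layer_on :: "nat \<Rightarrow> layer \<Rightarrow> bool" where
  "layer_on N L \<longleftrightarrow> (\<forall>g\<in>set L. proper_gate g \<and> gate_qubits g \<subseteq> {..<N}) \<and>
     sorted_wrt (\<lambda>g h. gate_qubits g \<inter> gate_qubits h = {}) L"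

definition circuit_on :: "nat \<Rightarrow> circuit \<Rightarrow> bool" where
  "circuit_on N C \<longleftrightarrow> (\<forall>L\<in>set C. layer_on N L)"

definition circuit_depth :: "circuit \<Rightarrow> nat" where
  "circuit_depth C = length C"

definition circuit_size :: "circuit \<Rightarrow> nat" where
  "circuit_size C = (\<Sum>L\<leftarrow>C. \<Sum>g\<leftarrow>L. gate_size g)"

definition run_circuit :: "nat \<Rightarrow> circuit \<Rightarrow> qvec \<Rightarrow> qvec" where
  "run_circuit N C \<psi> = fold (fold (apply_gate N)) C \<psi>"


section \<open>Approximation of operators\<close>

text \<open>
  An operator on \<open>k\<close> qubits may be partial: it is a linear, norm-preserving map \<open>V\<close> on a
  subspace \<open>D\<close>, its domain. The values of \<open>V\<close> outside \<open>D\<close> are irrelevant.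
\<close>

definition quantum_operator :: "nat \<Rightarrow> qvec set \<Rightarrow> (qvec \<Rightarrow> qvec) \<Rightarrow> bool" where
  "quantum_operator k D V \<longleftrightarrow>
     D \<subseteq> qspace k \<and> (\<lambda>x. 0) \<in> D \<and>
     (\<forall>\<phi>\<in>D. \<forall>\<psi>\<in>D. \<forall>\<alpha> \<beta>. (\<lambda>x. \<alpha> * \<phi> x + \<beta> * \<psi> x) \<in> D \<and>
        V (\<lambda>x. \<alpha> * \<phi> x + \<beta> * \<psi> x) = (\<lambda>x. \<alpha> * V \<phi> x + \<beta> * V \<psi> x)) \<and>
     (\<forall>\<psi>\<in>D. V \<psi> \<in> qspace k \<and> qnorm k (V \<psi>) = qnorm k \<psi>)"

text \<open>
  The circuit \<open>C\<close> acts on \<open>k + a\<close> qubits, the last \<open>a\<close> of which are ancillas that start, and up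
  to the error end, in the all-zero state.
\<close>

definition approximates ::
  "nat \<Rightarrow> nat \<Rightarrow> circuit \<Rightarrow> qvec set \<Rightarrow> (qvec \<Rightarrow> qvec) \<Rightarrow> real \<Rightarrow> bool" where
  "approximates k a C D V \<epsilon> \<longleftrightarrow>
     (\<forall>\<psi>\<in>D. qnorm k \<psi> = 1 \<longrightarrow>
        qnorm (k + a) (\<lambda>z. run_circuit (k + a) C (with_zeros k a \<psi>) z
                            - with_zeros k a (V \<psi>) z) \<le> \<epsilon>)"


section \<open>Counting\<close>

definition count_width :: "nat \<Rightarrow> nat" where
  "count_width n = nat \<lceil>log 2 (real n + 1)\<rceil>"

definition hamming_weight :: "bool list \<Rightarrow> nat" where
  "hamming_weight x = count_list x True"

text \<open>The \<open>m\<close> low-order binary digits of \<open>w\<close>, most significant digit first.\<close>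

definition binary :: "nat \<Rightarrow> nat \<Rightarrow> bool list" where
  "binary m w = rev (map (bit w) [0..<m])"

definition counting_operator :: "nat \<Rightarrow> qvec set \<Rightarrow> (qvec \<Rightarrow> qvec) \<Rightarrow> bool" where
  "counting_operator n D V \<longleftrightarrow>
     quantum_operator (n + count_width n) D V \<and>
     (\<forall>x\<in>bitstrings n.
        ket (x @ zeros (count_width n)) \<in> D \<and>
        V (ket (x @ zeros (count_width n))) = ket (x @ binary (count_width n) (hamming_weight x)))"

end

theory Submission
  imports Defs
begin

text \<open>
  The circuits below are exact. A diagonal operator whose phase is a real combination of ANDs of
  small sets of bits has constant depth: an AND is a combination of parities, and all the parities
  are computed side by side on fanned-out copies of the bits. Conjugating such an operator by
  Hadamard gates on qubits \<open>R\<close> decouples the qubits of \<open>R\<close>; a qubit that carries the phase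
  \<open>-1\<close> is flipped, one that carries the phase \<open>1\<close> is left alone.

  To find \<open>w mod 2^\<mu>\<close>, take for every candidate \<open>t < 2^\<mu>\<close> and every \<open>j < \<mu>\<close> a test
  qubit with phase \<open>2\<pi> ((w - t) / 2^(j+1) + 1/2)\<close>. For \<open>t = w mod 2^\<mu>\<close> all \<open>\<mu>\<close>
  tests are flipped, and for any other \<open>t\<close> the test at the 2-adic valuation \<open>j\<close> of \<open>w - t\<close> is
  certainly not flipped, although the remaining ones may be in superposition. So the ANDs of the
  tests of each \<open>t\<close> are deterministic, and undoing the tests restores the ancillas exactly.

  Applied directly this costs \<open>2^\<mu> \<mu>\<close> phases per input bit. But the phases depend on the test
  qubits only through one weighted sum \<open>S\<close>. Computing \<open>S\<close> first, by the same method, leaves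
  only \<open>O(n \<mu>)\<close> pairs of an input bit and a bit of \<open>S\<close>; everything else has size
  \<open>O(2^(8\<mu>))\<close>. With \<open>\<mu>\<close> about \<open>log n / 8\<close> this is \<open>O(n log n)\<close>, and eight rounds, each
  subtracting the digits already known, give all digits of the Hamming weight.
\<close>


section \<open>Hadamard gates and diagonal operators\<close>

text \<open>The phase that isolates digit j of w depends on the lower digits, so reading the digits
  one by one would take logarithmic depth. Guessing the lower digits as a candidate \<open>t\<close>
  removes this dependence, at the price of a factor 2^\<mu>. One block containing all digits would
  therefore need about n^2 phases, up to logarithmic factors; this forces a constant number of short
  blocks. The exponent 8 comes from the sum S. Scaled by 2^\<mu> it is an integer with 3\<mu> binary
  digits, so finding it takes 2^(3\<mu>) candidates, each decided by an AND of 3\<mu> tests, and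
  expanding such an AND into the parities of all subsets costs another factor 2^(3\<mu>). The
  remaining factor, \<mu>^2 up to a constant, is absorbed by 2^(2\<mu>). Parities in constant depth
  rest on the fact that Hadamard gates exchange the roles of source and targets in a fan-out gate.
  Exactness rests on phase gates with arbitrary angles being allowed as one-qubit gates.\<close>

definition had :: "nat \<Rightarrow> qvec \<Rightarrow> qvec" where
  "had q \<psi> = (\<lambda>y. (\<psi> (y[q := False]) + (if y ! q then -1 else 1) * \<psi> (y[q := True])) /
                complex_of_real (sqrt 2))"

text \<open>A set of qubits is enough, since Hadamard gates commute (\<open>had_commute\<close>). On
  an infinite set the fold is the identity.\<close>

definition Had :: "nat set \<Rightarrow> qvec \<Rightarrow> qvec" where
  "Had Q \<psi> = Finite_Set.fold had \<psi> Q"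

definition diag :: "(bool list \<Rightarrow> complex) \<Rightarrow> qvec \<Rightarrow> qvec" where
  "diag \<phi> \<psi> = (\<lambda>y. \<phi> y * \<psi> y)"

text \<open>All conditions are read from the old string, so the flips are simultaneous. Operators
  are written as pull-backs \<open>\<lambda>y. \<psi> (f y)\<close>; this sends \<open>ket x\<close>
  to \<open>ket (f x)\<close> when \<open>f\<close> is an involution, which holds here once no
  \<open>g i\<close> looks at a bit in \<open>R\<close>.\<close>

definition flips :: "nat set \<Rightarrow> (nat \<Rightarrow> bool list \<Rightarrow> bool) \<Rightarrow> bool list \<Rightarrow> bool list" where
  "flips R g y = map (\<lambda>i. if i \<in> R then y ! i \<noteq> g i y else y ! i) [0..<length y]"

lemma sqrt2_sq [simp]: "complex_of_real (sqrt 2) * complex_of_real (sqrt 2) = 2"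
  by (metis of_real_mult of_real_numeral real_sqrt_mult_self abs_numeral)

lemma qspaceD: "\<psi> \<in> qspace N \<Longrightarrow> length y \<noteq> N \<Longrightarrow> \<psi> y = 0"
  by (auto simp: qspace_def bitstrings_def)

lemma qspaceI: "(\<And>y. length y \<noteq> N \<Longrightarrow> \<psi> y = 0) \<Longrightarrow> \<psi> \<in> qspace N"
  by (auto simp: qspace_def bitstrings_def)

text \<open>\<open>nth\<close> beyond the end of a list is unspecified, so operator identities are
  checked on strings of length \<open>N\<close> only; all others carry amplitude zero.\<close>

lemma qspace_eqI:
  assumes "\<phi> \<in> qspace N" "\<psi> \<in> qspace N" "\<And>y. length y = N \<Longrightarrow> \<phi> y = \<psi> y"
  shows "\<phi> = \<psi>"
  using assms by (metis ext qspaceD)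

lemma length_flips [simp]: "length (flips R g y) = length y"
  by (simp add: flips_def)

lemma nth_flips:
  "i < length y \<Longrightarrow> flips R g y ! i = (if i \<in> R then y ! i \<noteq> g i y else y ! i)"
  by (simp add: flips_def)

lemma flips_flips:
  assumes "\<And>i. i \<in> R \<Longrightarrow> i < length y \<Longrightarrow> g i (flips R g y) = g i y"
  shows "flips R g (flips R g y) = y"
  by (rule nth_equalityI) (use assms in \<open>auto simp: nth_flips\<close>)

lemma had_qspace: "\<psi> \<in> qspace N \<Longrightarrow> had q \<psi> \<in> qspace N"
  by (auto simp: had_def qspace_def bitstrings_def)

lemma diag_qspace: "\<psi> \<in> qspace N \<Longrightarrow> diag \<phi> \<psi> \<in> qspace N"
  by (auto simp: diag_def qspace_def bitstrings_def)

lemma pull_qspace: "\<psi> \<in> qspace N \<Longrightarrow> (\<And>y. length (f y) = length y) \<Longrightarrow> (\<lambda>y. \<psi> (f y)) \<in> qspace N"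
  by (auto simp: qspace_def bitstrings_def)

lemma had_had:
  assumes "\<psi> \<in> qspace N" "q < N"
  shows "had q (had q \<psi>) = \<psi>"
proof (rule qspace_eqI[OF had_qspace[OF had_qspace[OF assms(1)]] assms(1)])
  fix y :: "bool list" assume "length y = N"
  then have "y[q := True] ! q" "\<not> y[q := False] ! q" "y[q := y ! q] = y"
    using assms by auto
  then show "had q (had q \<psi>) y = \<psi> y"
    by (cases "y ! q") (auto simp: had_def add_divide_distrib diff_divide_distrib)
qed

lemma had_commute: "had p (had q \<psi>) = had q (had p \<psi>)"
proof (cases "p = q")
  case False
  then show ?thesis
    by (intro ext) (simp add: had_def list_update_swap add_divide_distrib algebra_simps)
qed simp

interpretation had: comp_fun_commute had
  by standard (simp add: fun_eq_iff had_commute)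

lemma Had_empty [simp]: "Had {} \<psi> = \<psi>"
  by (simp add: Had_def)

lemma Had_insert: "finite Q \<Longrightarrow> q \<notin> Q \<Longrightarrow> Had (insert q Q) \<psi> = had q (Had Q \<psi>)"
  by (simp add: Had_def)

lemma had_Had: "finite Q \<Longrightarrow> had q (Had Q \<psi>) = Had Q (had q \<psi>)"
  by (simp add: Had_def had.fold_fun_left_comm)

lemma Had_insert2: "finite Q \<Longrightarrow> q \<notin> Q \<Longrightarrow> Had (insert q Q) \<psi> = Had Q (had q \<psi>)"
  by (simp add: Had_insert had_Had)

lemma fold_had: "distinct qs \<Longrightarrow> fold had qs \<psi> = Had (set qs) \<psi>"
  by (induction qs arbitrary: \<psi>) (simp_all add: Had_insert2)

lemma Had_Un: "finite P \<Longrightarrow> finite Q \<Longrightarrow> P \<inter> Q = {} \<Longrightarrow> Had (P \<union> Q) \<psi> = Had P (Had Q \<psi>)"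
  by (induction P rule: finite_induct) (simp_all add: Had_insert)

lemma Had_qspace:
  assumes "\<psi> \<in> qspace N" shows "Had Q \<psi> \<in> qspace N"
proof (cases "finite Q")
  case True then show ?thesis
    by (induction Q rule: finite_induct) (simp_all add: Had_insert assms had_qspace)
qed (simp add: Had_def assms)

lemma Had_Had:
  assumes "finite Q" "Q \<subseteq> {..<N}" "\<psi> \<in> qspace N"
  shows "Had Q (Had Q \<psi>) = \<psi>"
  using assms
proof (induction Q arbitrary: \<psi> rule: finite_induct)
  case (insert q Q)
  have "Had (insert q Q) (Had (insert q Q) \<psi>) = had q (Had Q (Had Q (had q \<psi>)))"
    using insert.hyps by (metis Had_insert Had_insert2)
  also have "\<dots> = \<psi>"
    using insert by (simp add: had_had had_qspace)
  finally show ?case .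
qed simp

lemma had_diag:
  assumes "\<And>y b. \<phi> (y[q := b]) = \<phi> y"
  shows "had q (diag \<phi> \<psi>) = diag \<phi> (had q \<psi>)"
  by (simp add: had_def diag_def assms fun_eq_iff algebra_simps)

lemma Had_diag:
  assumes "finite Q" "\<And>q y b. q \<in> Q \<Longrightarrow> \<phi> (y[q := b]) = \<phi> y"
  shows "Had Q (diag \<phi> \<psi>) = diag \<phi> (Had Q \<psi>)"
  using assms by (induction Q rule: finite_induct) (simp_all add: Had_insert had_diag)

lemma diag_diag: "diag \<phi> (diag \<chi> \<psi>) = diag (\<lambda>y. \<phi> y * \<chi> y) \<psi>"
  by (simp add: diag_def mult.assoc)

section \<open>Controlled phases conjugated by Hadamard gates\<close>

definition bit_phase :: "(nat \<Rightarrow> bool list \<Rightarrow> complex) \<Rightarrow> nat \<Rightarrow> bool list \<Rightarrow> complex" where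
  "bit_phase c q y = (if y ! q then c q y else 1)"

definition rot :: "(nat \<Rightarrow> bool list \<Rightarrow> complex) \<Rightarrow> nat \<Rightarrow> qvec \<Rightarrow> qvec" where
  "rot c q \<psi> = had q (diag (bit_phase c q) (had q \<psi>))"

text \<open>The matrix H diag(1, c) H equals ((1 + c) I + (1 - c) X) / 2. Hence c = 1 leaves the
  qubit alone, c = -1 flips it, and any other phase yields a superposition.\<close>

lemma rot_apply:
  assumes "q < length y" "\<And>b. c q (y[q := b]) = c q y"
  shows "rot c q \<psi> y = (1 + c q y) / 2 * \<psi> y + (1 - c q y) / 2 * \<psi> (y[q := \<not> y ! q])"
proof -
  have *: "y[q := True] ! q" "\<not> y[q := False] ! q" "y[q := y ! q] = y"
    using assms by auto
  have **: "c q (y[q := False]) = c q y" "c q (y[q := True]) = c q y"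
    using assms by simp_all
  show ?thesis
    using *(3)
    by (cases "y ! q")
       (simp_all add: rot_def had_def diag_def bit_phase_def *(1,2) ** field_simps assms(1))
qed

definition conj_phase :: "(nat \<Rightarrow> bool list \<Rightarrow> complex) \<Rightarrow> nat set \<Rightarrow> qvec \<Rightarrow> qvec" where
  "conj_phase c R \<psi> = Had R (diag (\<lambda>y. \<Prod>q\<in>R. bit_phase c q y) (Had R \<psi>))"

lemma conj_phase_qspace: "\<psi> \<in> qspace N \<Longrightarrow> conj_phase c R \<psi> \<in> qspace N"
  by (simp add: conj_phase_def Had_qspace diag_qspace)

lemma conj_phase_empty [simp]: "conj_phase c {} \<psi> = \<psi>"
  by (simp add: conj_phase_def diag_def)

text \<open>No phase \<open>c p\<close> looks at a qubit of the set, so the Hadamard gates of one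
  qubit pass through the controlled phases of the others and the conjugation splits into one-qubit
  rotations.\<close>

lemma conj_phase_insert:
  assumes "finite R" "q \<notin> R"
    and inv: "\<And>p p' y b. p \<in> insert q R \<Longrightarrow> p' \<in> insert q R \<Longrightarrow> c p (y[p' := b]) = c p y"
  shows "conj_phase c (insert q R) \<psi> = rot c q (conj_phase c R \<psi>)"
proof -
  let ?d = "\<lambda>y. \<Prod>q\<in>R. bit_phase c q y"
  have 1: "had q (diag ?d \<chi>) = diag ?d (had q \<chi>)" for \<chi>
  proof (rule had_diag, rule prod.cong[OF refl])
    fix y :: "bool list" and b p
    assume "p \<in> R"
    moreover from this have "q \<noteq> p" using assms(2) by auto
    ultimately show "bit_phase c p (y[q := b]) = bit_phase c p y"
      by (simp add: bit_phase_def inv)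
  qed
  have 2: "Had R (diag (bit_phase c q) \<chi>) = diag (bit_phase c q) (Had R \<chi>)" for \<chi>
  proof (rule Had_diag[OF assms(1)])
    fix y :: "bool list" and b p
    assume "p \<in> R"
    moreover from this have "q \<noteq> p" using assms(2) by auto
    ultimately show "bit_phase c q (y[p := b]) = bit_phase c q y"
      by (simp add: bit_phase_def inv)
  qed
  have "conj_phase c (insert q R) \<psi> =
      had q (Had R (diag (bit_phase c q) (diag ?d (had q (Had R \<psi>)))))"
    using assms(1,2) by (simp add: conj_phase_def Had_insert diag_diag)
  also have "\<dots> = rot c q (conj_phase c R \<psi>)"
    by (simp add: rot_def conj_phase_def had_Had[OF assms(1)] 1 2)
  finally show ?thesis .
qed

text \<open>With signs as phases every rotation is the identity or a bit flip. This converts a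
  diagonal operator into a classical reversible map.\<close>

lemma conj_phase_flips:
  assumes "finite R" "R \<subseteq> {..<N}" "\<psi> \<in> qspace N"
    and "\<And>p p' y b. p \<in> R \<Longrightarrow> p' \<in> R \<Longrightarrow> g p (y[p' := b]) = g p y"
  shows "conj_phase (\<lambda>q y. if g q y then -1 else 1) R \<psi> = (\<lambda>y. \<psi> (flips R g y))"
  using assms
proof (induction R rule: finite_induct)
  case empty
  have "flips {} g y = y" for y by (rule nth_equalityI) (auto simp: nth_flips)
  then show ?case by simp
next
  case (insert q R)
  let ?c = "\<lambda>q y. if g q y then -1 else (1::complex)"
  have IH: "conj_phase ?c R \<psi> = (\<lambda>y. \<psi> (flips R g y))"
    using insert by simp
  have inv: "?c p (y[p' := b]) = ?c p y" if "p \<in> insert q R" "p' \<in> insert q R" for p p' y b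
    using insert.prems(3)[OF that] by simp
  show ?case
  proof (rule qspace_eqI)
    fix y :: "bool list" assume y: "length y = N"
    have q: "q < length y" using insert.prems y by auto
    have eq1: "flips (insert q R) g y = flips R g y" if "\<not> g q y"
      by (rule nth_equalityI) (use that in \<open>auto simp: nth_flips\<close>)
    have eq2: "flips (insert q R) g y = flips R g (y[q := \<not> y ! q])" if "g q y"
      by (rule nth_equalityI)
        (use that insert q in \<open>auto simp: nth_flips nth_list_update\<close>)
    show "conj_phase ?c (insert q R) \<psi> y = \<psi> (flips (insert q R) g y)"
    proof -
      have "conj_phase ?c (insert q R) \<psi> = rot ?c q (\<lambda>y. \<psi> (flips R g y))"
        using conj_phase_insert[where c = ?c, OF insert.hyps inv] IH by simp
      then show ?thesis
        using rot_apply[of q y ?c, OF q] inv eq1 eq2 by (cases "g q y") auto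
    qed
  qed (use insert in \<open>auto intro: conj_phase_qspace pull_qspace\<close>)
qed

text \<open>Nothing is claimed about qubits whose phase is neither 1 nor -1, as they may be in
  superposition. The digit extraction relies on the certain ones alone.\<close>

lemma conj_phase_support:
  assumes "finite R" "R \<subseteq> {..<N}" "x \<in> bitstrings N" "conj_phase (\<lambda>q _. c q) R (ket x) y \<noteq> 0"
  shows "length y = N \<and> (\<forall>i<N. i \<notin> R \<longrightarrow> y ! i = x ! i) \<and>
    (\<forall>q\<in>R. (c q = 1 \<longrightarrow> y ! q = x ! q) \<and> (c q = -1 \<longrightarrow> y ! q = (\<not> x ! q)))"
  using assms
proof (induction R arbitrary: y rule: finite_induct)
  case empty
  then show ?case by (auto simp: ket_def bitstrings_def split: if_splits)
next
  case (insert q R)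
  let ?\<psi> = "conj_phase (\<lambda>q _. c q) R (ket x)"
  have ket: "ket x \<in> qspace N" using insert.prems by (auto simp: ket_def qspace_def)
  have y: "length y = N"
    using insert.prems(3) conj_phase_qspace[OF ket] qspaceD by blast
  then have q: "q < length y" using insert.prems by auto
  have "conj_phase (\<lambda>q _. c q) (insert q R) (ket x) y = rot (\<lambda>q _. c q) q ?\<psi> y"
    using insert.hyps by (subst conj_phase_insert) auto
  also have "\<dots> = (1 + c q) / 2 * ?\<psi> y + (1 - c q) / 2 * ?\<psi> (y[q := \<not> y ! q])"
    by (subst rot_apply[OF q]) auto
  finally have "(1 + c q) / 2 * ?\<psi> y + (1 - c q) / 2 * ?\<psi> (y[q := \<not> y ! q]) \<noteq> 0"
    using insert.prems(3) by simp
  \<comment> \<open>The two summands belong to the bit \<open>q\<close> being kept and being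
    flipped; a non-zero one excludes \<open>c q = -1\<close> or \<open>c q = 1\<close>,
    respectively.\<close>
  then consider "c q \<noteq> -1" "?\<psi> y \<noteq> 0" | "c q \<noteq> 1" "?\<psi> (y[q := \<not> y ! q]) \<noteq> 0"
    by (metis add.right_inverse add_cancel_right_left diff_self div_0 mult_zero_left mult_zero_right)
  then show ?case
  proof cases
    case 1
    then show ?thesis using insert.IH[OF _ _ 1(2)] insert.prems insert.hyps q y
      by (auto)
  next
    case 2
    note IH = insert.IH[OF _ _ 2(2)]
    have a: "\<forall>i<N. i \<notin> insert q R \<longrightarrow> y ! i = x ! i"
      using IH insert.prems by (auto simp: nth_list_update)
    have b: "\<forall>p\<in>R. p \<noteq> q" using insert.hyps by auto
    have c: "(\<not> y ! q) = x ! q"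
      using IH insert.prems insert.hyps q y by (auto simp: nth_list_update)
    have d: "y[q := \<not> y ! q] ! p = y ! p" if "p \<in> R" for p
      using b that nth_list_update_neq by metis
    show ?thesis using IH insert.prems a c 2(1) y d by auto
  qed
qed


section \<open>Implementable operators\<close>

lemma with_zeros_apply:
  "length z = N + a \<Longrightarrow> with_zeros N a \<psi> z = (if drop N z = zeros a then \<psi> (take N z) else 0)"
  by (auto simp: with_zeros_def ket_def)

lemma with_zeros_qspace:
  assumes "\<psi> \<in> qspace N" shows "with_zeros N a \<psi> \<in> qspace (N + a)"
proof (rule qspaceI)
  fix z :: "bool list" assume z: "length z \<noteq> N + a"
  show "with_zeros N a \<psi> z = 0"
  proof (cases "length (take N z) = N \<and> drop N z = zeros a")
    case True
    then have "length (take N z @ drop N z) = N + a" by (metis length_append length_replicate)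
    then show ?thesis using z by (simp only: append_take_drop_id)
  next
    case False
    then show ?thesis
      using qspaceD[OF assms, of "take N z"] by (auto simp: with_zeros_def ket_def)
  qed
qed

lemma with_zeros_append: "length x = N \<Longrightarrow> with_zeros N a \<psi> (x @ zeros a) = \<psi> x"
  by (simp add: with_zeros_apply)

lemma with_zeros_add:
  assumes "\<psi> \<in> qspace N"
  shows "with_zeros (N + l) a (with_zeros N l \<psi>) = with_zeros N (l + a) \<psi>"
proof (rule qspace_eqI)
  show "with_zeros N (l + a) \<psi> \<in> qspace (N + l + a)"
    using with_zeros_qspace[OF assms, of "l + a"] by (simp add: add.assoc)
  fix z :: "bool list" assume z: "length z = N + l + a"
  have "drop N z = drop N (take (N + l) z) @ drop (N + l) z"
    by (metis add_diff_cancel_left' append_take_drop_id drop_drop drop_take add.commute)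
  moreover have "length (drop N (take (N + l) z)) = l" using z by simp
  ultimately have "drop N z = zeros (l + a) \<longleftrightarrow>
      drop N (take (N + l) z) = zeros l \<and> drop (N + l) z = zeros a"
    by (simp add: replicate_add)
  then show "with_zeros (N + l) a (with_zeros N l \<psi>) z = with_zeros N (l + a) \<psi> z"
    using z by (auto simp: with_zeros_apply)
qed (intro with_zeros_qspace assms)

lemma ket_qspace: "length x = N \<Longrightarrow> ket x \<in> qspace N"
  by (auto simp: ket_def qspace_def bitstrings_def)

lemma with_zeros_ket: 
  assumes "length x = N" shows "with_zeros N a (ket x) = ket (x @ zeros a)"
proof (rule qspace_eqI[OF with_zeros_qspace[OF ket_qspace[OF assms]] ket_qspace])
  fix z :: "bool list" assume "length z = N + a"
  then show "with_zeros N a (ket x) z = ket (x @ zeros a) z"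
    using assms append_eq_conv_conj[of x "zeros a" z]
    by (auto simp: with_zeros_apply ket_def)
qed (use assms in simp)

lemma finite_bitstrings [simp]: "finite (bitstrings N)"
  using finite_lists_length_eq[of "UNIV :: bool set" N] by (simp add: bitstrings_def)

lemma qspace_expand:
  assumes "\<psi> \<in> qspace N" shows "\<psi> = (\<lambda>y. \<Sum>x\<in>bitstrings N. \<psi> x * ket x y)"
proof
  fix y
  have "(\<Sum>x\<in>bitstrings N. \<psi> x * ket x y) = (\<Sum>x\<in>bitstrings N. if x = y then \<psi> y else 0)"
    by (rule sum.cong) (auto simp: ket_def)
  also have "\<dots> = \<psi> y"
    by (subst sum.delta[OF finite_bitstrings])
       (use qspaceD[OF assms, of y] in \<open>auto simp: bitstrings_def\<close>)
  finally show "\<psi> y = (\<Sum>x\<in>bitstrings N. \<psi> x * ket x y)" by simp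
qed

lemma basis_map_sum:
  "basis_map N f (\<lambda>y. \<Sum>x\<in>X. k x * v x y) = (\<lambda>y. \<Sum>x\<in>X. k x * basis_map N f (v x) y)"
  unfolding basis_map_def by (subst sum.swap) (simp add: sum_distrib_left)

lemma apply_gate_sum:
  "apply_gate N g (\<lambda>y. \<Sum>x\<in>X. k x * v x y) = (\<lambda>y. \<Sum>x\<in>X. k x * apply_gate N g (v x) y)"
proof (cases g)
  case (OneQubit u q)
  then show ?thesis
    by (simp add: UNIV_bool sum_distrib_left distrib_left sum.distrib mult.left_commute)
qed (simp_all add: basis_map_sum)

lemma fold_gates_sum:
  "fold (apply_gate N) L (\<lambda>y. \<Sum>x\<in>X. k x * v x y) =
   (\<lambda>y. \<Sum>x\<in>X. k x * fold (apply_gate N) L (v x) y)"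
  by (induction L arbitrary: v) (simp_all add: apply_gate_sum)

lemma run_circuit_sum:
  "run_circuit N C (\<lambda>y. \<Sum>x\<in>X. k x * v x y) = (\<lambda>y. \<Sum>x\<in>X. k x * run_circuit N C (v x) y)"
  unfolding run_circuit_def by (induction C arbitrary: v) (simp_all add: fold_gates_sum)

section \<open>Operators computed with restored ancillas\<close>

text \<open>
  Only the required number of ancillas is bounded below, so that circuits with different needs can
  be composed and qubits hidden without renumbering.
\<close>

definition implements :: "nat \<Rightarrow> nat \<Rightarrow> nat \<Rightarrow> nat \<Rightarrow> (qvec \<Rightarrow> qvec) \<Rightarrow> circuit \<Rightarrow> bool" where
  "implements N a d s A C \<longleftrightarrow>
     circuit_on (N + a) C \<and> circuit_depth C \<le> d \<and> circuit_size C \<le> s \<and>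
     (\<forall>\<psi>\<in>qspace N. run_circuit (N + a) C (with_zeros N a \<psi>) = with_zeros N a (A \<psi>))"

definition implementable :: "nat \<Rightarrow> nat \<Rightarrow> nat \<Rightarrow> (qvec \<Rightarrow> qvec) \<Rightarrow> bool" where
  "implementable N d s A \<longleftrightarrow> (\<forall>\<psi>\<in>qspace N. A \<psi> \<in> qspace N) \<and>
     (\<exists>a0. \<forall>a\<ge>a0. \<exists>C. implements N a d s A C)"

lemma implementable_qspace: "implementable N d s A \<Longrightarrow> \<psi> \<in> qspace N \<Longrightarrow> A \<psi> \<in> qspace N"
  unfolding implementable_def by blast

lemma implementable_mono:
  assumes "implementable N d s A" "d \<le> d'" "s \<le> s'"
  shows "implementable N d' s' A"
proof -
  have "implements N a d' s' A C" if "implements N a d s A C" for a C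
    using that assms(2,3) by (simp add: implements_def)
  then show ?thesis using assms(1) unfolding implementable_def by blast
qed

lemma implementable_cong:
  assumes "implementable N d s A" and eq: "\<And>\<psi>. \<psi> \<in> qspace N \<Longrightarrow> A \<psi> = B \<psi>"
  shows "implementable N d s B"
proof -
  have "implements N a d s B C" if "implements N a d s A C" for a C
    using that by (simp add: implements_def eq)
  moreover have "B \<psi> \<in> qspace N" if "\<psi> \<in> qspace N" for \<psi>
    using implementable_qspace[OF assms(1) that] eq[OF that] by simp
  ultimately show ?thesis using assms(1) unfolding implementable_def by blast
qed

lemma implements_comp:
  assumes C: "implements N a d s A C" and D: "implements N a d' s' B D"
    and A: "\<And>\<psi>. \<psi> \<in> qspace N \<Longrightarrow> A \<psi> \<in> qspace N"
  shows "implements N a (d + d') (s + s') (\<lambda>\<psi>. B (A \<psi>)) (C @ D)"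
proof -
  have "run_circuit (N + a) (C @ D) (with_zeros N a \<psi>) = with_zeros N a (B (A \<psi>))"
    if "\<psi> \<in> qspace N" for \<psi>
  proof -
    have "run_circuit (N + a) (C @ D) (with_zeros N a \<psi>) =
        run_circuit (N + a) D (run_circuit (N + a) C (with_zeros N a \<psi>))"
      by (simp add: run_circuit_def)
    then show ?thesis using C D A[OF that] that by (simp add: implements_def)
  qed
  then show ?thesis
    using C D
    by (auto simp: implements_def circuit_on_def circuit_depth_def circuit_size_def)
qed

lemma implementable_comp:
  assumes "implementable N d s A" "implementable N d' s' B"
  shows "implementable N (d + d') (s + s') (\<lambda>\<psi>. B (A \<psi>))"
proof -
  obtain a0 where a0: "\<And>a. a \<ge> a0 \<Longrightarrow> \<exists>C. implements N a d s A C"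
    using assms(1) unfolding implementable_def by blast
  obtain b0 where b0: "\<And>a. a \<ge> b0 \<Longrightarrow> \<exists>C. implements N a d' s' B C"
    using assms(2) unfolding implementable_def by blast
  have "\<exists>C. implements N a (d + d') (s + s') (\<lambda>\<psi>. B (A \<psi>)) C" if "a \<ge> max a0 b0" for a
    using a0[of a] b0[of a] that implements_comp implementable_qspace[OF assms(1)]
    by (metis max.boundedE)
  then show ?thesis
    using implementable_qspace[OF assms(1)] implementable_qspace[OF assms(2)] unfolding implementable_def by blast
qed

text \<open>Work qubits that start and end in zero can be counted as ancillas. \<open>B\<close> is
  constrained only on states with these qubits in zero; its behaviour elsewhere is free.\<close>

lemma implementable_hide:
  assumes "implementable (N + l) d s B"
    and A: "\<And>\<psi>. \<psi> \<in> qspace N \<Longrightarrow> A \<psi> \<in> qspace N"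
    and B: "\<And>\<psi>. \<psi> \<in> qspace N \<Longrightarrow> B (with_zeros N l \<psi>) = with_zeros N l (A \<psi>)"
  shows "implementable N d s A"
proof -
  obtain a0 where a0: "\<And>a. a \<ge> a0 \<Longrightarrow> \<exists>C. implements (N + l) a d s B C"
    using assms(1) unfolding implementable_def by blast
  have "\<exists>C. implements N a d s A C" if "a \<ge> l + a0" for a
  proof -
    obtain b where b: "a = l + b" "b \<ge> a0"
      using \<open>a \<ge> l + a0\<close> by (metis add.assoc le_add1 le_iff_add)
    obtain C where C: "implements (N + l) b d s B C" using a0[OF b(2)] by blast
    have "run_circuit (N + a) C (with_zeros N a \<psi>) = with_zeros N a (A \<psi>)"
      if \<psi>: "\<psi> \<in> qspace N" for \<psi>
    proof -
      have "run_circuit (N + a) C (with_zeros (N + l) b (with_zeros N l \<psi>)) =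
          with_zeros (N + l) b (with_zeros N l (A \<psi>))"
        using C with_zeros_qspace[OF \<psi>, of l]
        by (simp add: implements_def B[OF \<psi>] b(1) add.assoc)
      then show ?thesis
        by (simp only: with_zeros_add[OF \<psi>] with_zeros_add[OF A[OF \<psi>]] b(1))
    qed
    then have "implements N a d s A C"
      using C by (simp add: implements_def b(1) add.assoc)
    then show ?thesis ..
  qed
  then show ?thesis using A unfolding implementable_def by blast
qed

text \<open>\<open>implementable\<close> does not ask for linearity. It is inherited from the
  circuit, because \<open>A \<psi>\<close> can be read off the amplitudes with all ancillas zero.
  Operators then need to be examined on basis vectors only.\<close>

lemma implementable_linear:
  assumes "implementable N d s A" "\<psi> \<in> qspace N"
  shows "A \<psi> = (\<lambda>y. \<Sum>x\<in>bitstrings N. \<psi> x * A (ket x) y)"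
proof -
  obtain a C where C: "\<And>\<psi>. \<psi>\<in>qspace N \<Longrightarrow>
      run_circuit (N + a) C (with_zeros N a \<psi>) = with_zeros N a (A \<psi>)"
    using assms(1) unfolding implementable_def implements_def by blast
  have *: "with_zeros N a \<psi> = (\<lambda>z. \<Sum>x\<in>bitstrings N. \<psi> x * with_zeros N a (ket x) z)"
    by (subst qspace_expand[OF assms(2)])
      (simp add: with_zeros_def sum_distrib_right mult.assoc)
  have **: "with_zeros N a (A \<psi>) = (\<lambda>z. \<Sum>x\<in>bitstrings N. \<psi> x * with_zeros N a (A (ket x)) z)"
    unfolding C[OF assms(2), symmetric] * run_circuit_sum
    by (intro ext sum.cong refl) (simp add: C ket_qspace bitstrings_def)
  show ?thesis
  proof (rule qspace_eqI[OF implementable_qspace[OF assms]])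
    show "(\<lambda>y. \<Sum>x\<in>bitstrings N. \<psi> x * A (ket x) y) \<in> qspace N"
      by (rule qspaceI)
        (auto intro!: sum.neutral simp: bitstrings_def qspaceD[OF implementable_qspace[OF assms(1) ket_qspace]])
    fix y :: "bool list" assume "length y = N"
    then show "A \<psi> y = (\<Sum>x\<in>bitstrings N. \<psi> x * A (ket x) y)"
      using fun_cong[OF **, of "y @ zeros a"] by (simp add: with_zeros_append)
  qed
qed


section \<open>Layers of gates\<close>

definition had_matrix :: "bool \<Rightarrow> bool \<Rightarrow> complex" where
  "had_matrix i j = (if i \<and> j then -1 else 1) / complex_of_real (sqrt 2)"

definition phase_matrix :: "real \<Rightarrow> bool \<Rightarrow> bool \<Rightarrow> complex" where
  "phase_matrix \<theta> i j = (if i = j then if i then cis \<theta> else 1 else 0)"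

lemma unitary2_had: "unitary2 had_matrix"
  by (auto simp: unitary2_def had_matrix_def UNIV_bool)

lemma unitary2_phase: "unitary2 (phase_matrix \<theta>)"
  by (auto simp: unitary2_def phase_matrix_def UNIV_bool cis_cnj cis_mult)

lemma apply_gate_had: "apply_gate N (OneQubit had_matrix q) = had q"
  by (intro ext) (simp add: had_matrix_def had_def UNIV_bool add_divide_distrib)

lemma apply_gate_phase:
  "apply_gate N (OneQubit (phase_matrix \<theta>) q) = diag (\<lambda>y. if y ! q then cis \<theta> else 1)"
proof (intro ext)
  fix \<psi> y
  show "apply_gate N (OneQubit (phase_matrix \<theta>) q) \<psi> y =
      diag (\<lambda>y. if y ! q then cis \<theta> else 1) \<psi> y"
    using list_update_id[of y q]
    by (cases "y ! q") (simp_all add: phase_matrix_def diag_def UNIV_bool)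
qed

lemma xor_bits_eq_flips: "xor_bits s T = flips T (\<lambda>_ y. y ! s)"
  by (intro ext) (simp add: xor_bits_def flips_def)

text \<open>Fan-out is its own inverse because the source is not a target, so the push-forward of
  \<open>basis_map\<close> equals the pull-back.\<close>

lemma apply_gate_fan:
  assumes "s \<notin> T" "s < N" "\<psi> \<in> qspace N"
  shows "apply_gate N (FanOut s T) \<psi> = (\<lambda>y. \<psi> (flips T (\<lambda>_ y. y ! s) y))"
proof (rule qspace_eqI)
  let ?f = "flips T (\<lambda>_ y. y ! s)"
  have ff: "?f (?f y) = y" if "length y = N" for y
    by (rule flips_flips) (use assms that in \<open>auto simp: nth_flips\<close>)
  show "apply_gate N (FanOut s T) \<psi> \<in> qspace N"
  proof (rule qspaceI)
    fix y :: "bool list" assume "length y \<noteq> N"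
    then have E: "{x. x \<in> bitstrings N \<and> ?f x = y} = {}"
      unfolding bitstrings_def using length_flips[of T "\<lambda>_ y. y ! s"] by blast
    show "apply_gate N (FanOut s T) \<psi> y = 0"
      by (simp only: apply_gate.simps basis_map_def xor_bits_eq_flips E sum.empty)
  qed
  fix y :: "bool list" assume y: "length y = N"
  have "x \<in> bitstrings N \<and> ?f x = y \<longleftrightarrow> x = ?f y" for x
  proof
    assume x: "x \<in> bitstrings N \<and> ?f x = y"
    then have "?f (?f x) = x" by (intro ff) (simp add: bitstrings_def)
    then show "x = ?f y" using x by simp
  next
    assume x: "x = ?f y"
    show "x \<in> bitstrings N \<and> ?f x = y"
      unfolding x ff[OF y] using y by (simp add: bitstrings_def)
  qed
  then have "{x. x \<in> bitstrings N \<and> ?f x = y} = {?f y}"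
    by blast
  then show "apply_gate N (FanOut s T) \<psi> y = \<psi> (?f y)"
    by (simp add: basis_map_def xor_bits_eq_flips)
qed (rule pull_qspace[OF assms(3)], simp)

lemma had_layer:
  "distinct qs \<Longrightarrow> fold (apply_gate N) (map (OneQubit had_matrix) qs) \<psi> = Had (set qs) \<psi>"
  by (simp del: apply_gate.simps add: fold_map comp_def apply_gate_had fold_had)

lemma phase_layer:
  "distinct as \<Longrightarrow> fold (apply_gate N) (map (\<lambda>a. OneQubit (phase_matrix (\<theta> a)) (p a)) as) \<psi> =
     diag (\<lambda>y. \<Prod>a\<in>set as. if y ! p a then cis (\<theta> a) else 1) \<psi>"
proof (induction as arbitrary: \<psi>)
  case (Cons a as)
  then show ?case
    by (simp del: apply_gate.simps add: apply_gate_phase) (simp add: diag_def fun_eq_iff)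
qed (simp add: diag_def)

text \<open>\<open>src\<close> recovers the source from a target, so the target sets are disjoint.
  As no source is a target either, the whole layer is one simultaneous flip.\<close>

lemma fan_layer:
  assumes "distinct ss" "set ss \<subseteq> {..<N}" "\<psi> \<in> qspace N"
    and "\<And>s. s \<in> set ss \<Longrightarrow> set ss \<inter> T s = {}"
    and "\<And>s t. s \<in> set ss \<Longrightarrow> t \<in> T s \<Longrightarrow> t < N \<and> src t = s"
  shows "fold (apply_gate N) (map (\<lambda>s. FanOut s (T s)) ss) \<psi> =
    (\<lambda>y. \<psi> (flips (\<Union>s\<in>set ss. T s) (\<lambda>i y. y ! src i) y))"
  using assms
proof (induction ss arbitrary: \<psi>)
  case Nil
  have "flips {} g y = y" for y g by (rule nth_equalityI) (auto simp: nth_flips)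
  then show ?case by simp
next
  case (Cons s ss)
  let ?g = "\<lambda>i y. y ! src i" and ?U = "\<Union>s\<in>set ss. T s"
  have 1: "apply_gate N (FanOut s (T s)) \<psi> = (\<lambda>y. \<psi> (flips (T s) (\<lambda>_ y. y ! s) y))"
    by (rule apply_gate_fan) (use Cons.prems in auto)
  have 2: "(\<lambda>y. \<psi> (flips (T s) (\<lambda>_ y. y ! s) y)) \<in> qspace N"
    using Cons.prems(3) by (rule pull_qspace) simp
  have 3: "fold (apply_gate N) (map (\<lambda>s. FanOut s (T s)) (s # ss)) \<psi> =
      (\<lambda>y. \<psi> (flips (T s) (\<lambda>_ y. y ! s) (flips ?U ?g y)))"
    unfolding list.map fold_simps comp_def 1
    by (rule Cons.IH[OF _ _ 2]) (use Cons.prems in auto)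
  show ?case
    unfolding 3
  proof (rule qspace_eqI)
    fix y :: "bool list" assume y: "length y = N"
    have "flips (T s) (\<lambda>_ y. y ! s) (flips ?U ?g y) = flips (\<Union>s\<in>set (s # ss). T s) ?g y"
    proof (rule nth_equalityI)
      fix i assume "i < length (flips (T s) (\<lambda>_ y. y ! s) (flips ?U ?g y))"
      then have i: "i < N" using y by simp
      have s: "s < N" "s \<notin> ?U" using Cons.prems by auto
      have "i \<notin> T s'" if "i \<in> T s" "s' \<in> set ss" for s'
        using Cons.prems(5)[of s i] Cons.prems(5)[of s' i] Cons.prems(1) that by auto
      then have "i \<in> T s \<Longrightarrow> i \<notin> ?U" by blast
      moreover have "i \<in> T s \<Longrightarrow> src i = s" using Cons.prems(5) by auto
      ultimately show "flips (T s) (\<lambda>_ y. y ! s) (flips ?U ?g y) ! i =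
          flips (\<Union>s\<in>set (s # ss). T s) ?g y ! i"
        using i s y by (auto simp: nth_flips)
    qed simp
    then show "\<psi> (flips (T s) (\<lambda>_ y. y ! s) (flips ?U ?g y)) =
        \<psi> (flips (\<Union>s\<in>set (s # ss). T s) ?g y)" by simp
  qed (rule pull_qspace[OF Cons.prems(3)], simp)+
qed

lemma sorted_wrt_distinct:
  "distinct xs \<Longrightarrow> (\<And>x y. x \<in> set xs \<Longrightarrow> y \<in> set xs \<Longrightarrow> x \<noteq> y \<Longrightarrow> P x y) \<Longrightarrow> sorted_wrt P xs"
  by (induction xs) auto

lemma layer_on_map:
  assumes "distinct xs" "\<And>x. x \<in> set xs \<Longrightarrow> proper_gate (G x) \<and> gate_qubits (G x) \<subseteq> {..<N}"
    and "\<And>x y. x \<in> set xs \<Longrightarrow> y \<in> set xs \<Longrightarrow> x \<noteq> y \<Longrightarrow> gate_qubits (G x) \<inter> gate_qubits (G y) = {}"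
  shows "layer_on N (map G xs)"
proof -
  have "sorted_wrt (\<lambda>x y. gate_qubits (G x) \<inter> gate_qubits (G y) = {}) xs"
    by (rule sorted_wrt_distinct[OF assms(1)]) (rule assms(3))
  then show ?thesis
    using assms(2) by (auto simp: layer_on_def sorted_wrt_map)
qed

text \<open>Gates of a layer do not overlap, so the size of a layer is found by counting the qubits
  it touches.\<close>

lemma layer_size:
  assumes "layer_on N L"
  shows "(\<Sum>g\<leftarrow>L. gate_size g) = card (\<Union>g\<in>set L. gate_qubits g)"
  using assms
proof (induction L)
  case (Cons g L)
  have fin: "finite (gate_qubits h)" if "h \<in> set (g # L)" for h
    using Cons.prems that finite_subset[of _ "{..<N}"] by (auto simp: layer_on_def)
  have "card (gate_qubits g \<union> (\<Union>g\<in>set L. gate_qubits g)) =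
      card (gate_qubits g) + card (\<Union>g\<in>set L. gate_qubits g)"
    by (rule card_Un_disjoint) (use Cons.prems fin in \<open>auto simp: layer_on_def\<close>)
  moreover have "layer_on N L" using Cons.prems by (simp add: layer_on_def)
  ultimately show ?case using Cons.IH by (simp add: gate_size_def)
qed simp

lemma layer_size_le:
  assumes "layer_on N L" "\<And>g. g \<in> set L \<Longrightarrow> gate_qubits g \<subseteq> Q" "finite Q" "card Q \<le> k"
  shows "(\<Sum>g\<leftarrow>L. gate_size g) \<le> k"
proof -
  have "card (\<Union>g\<in>set L. gate_qubits g) \<le> card Q"
    using assms by (intro card_mono) auto
  then show ?thesis using assms(4) by (simp add: layer_size[OF assms(1)])
qed

lemma Had_with_zeros:
  assumes "Q \<subseteq> {..<N}" "finite Q" "\<psi> \<in> qspace N"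
  shows "Had Q (with_zeros N a \<psi>) = with_zeros N a (Had Q \<psi>)"
  using assms(2,1)
proof (induction Q rule: finite_induct)
  case (insert q Q)
  have "had q (with_zeros N a \<phi>) = with_zeros N a (had q \<phi>)" if "\<phi> \<in> qspace N" for \<phi>
  proof (rule qspace_eqI)
    fix y :: "bool list" assume "length y = N + a"
    then show "had q (with_zeros N a \<phi>) y = with_zeros N a (had q \<phi>) y"
      using insert.prems by (simp add: had_def with_zeros_apply take_update_swap)
  qed (intro had_qspace with_zeros_qspace that)+
  then show ?case
    using insert assms(3) by (simp add: Had_insert Had_qspace)
qed simp

lemma implementable_Had:
  assumes "Q \<subseteq> {..<N}"
  shows "implementable N 1 (card Q) (Had Q)"
proof -
  have fin: "finite Q" using assms finite_subset by blast
  let ?qs = "sorted_list_of_set Q"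
  let ?L = "map (OneQubit had_matrix) ?qs"
  have "implements N a 1 (card Q) (Had Q) [?L]" for a
  proof -
    have L: "layer_on (N + a) ?L"
      using assms fin by (intro layer_on_map) (auto simp: unitary2_had)
    have "(\<Sum>g\<leftarrow>?L. gate_size g) \<le> card Q"
      by (rule layer_size_le[OF L]) (use fin in auto)
    moreover have "run_circuit (N + a) [?L] (with_zeros N a \<psi>) = with_zeros N a (Had Q \<psi>)"
      if "\<psi> \<in> qspace N" for \<psi>
      using Had_with_zeros[OF assms fin that] had_layer[of ?qs] fin by (simp add: run_circuit_def)
    ultimately show ?thesis
      using L by (simp add: implements_def circuit_on_def circuit_depth_def circuit_size_def)
  qed
  then show ?thesis using Had_qspace unfolding implementable_def by blast
qed


section \<open>Phases of parities\<close>

definition parity :: "nat set \<Rightarrow> bool list \<Rightarrow> bool" where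
  "parity S y \<longleftrightarrow> odd (card {q \<in> S. y ! q})"

lemma prod_sign:
  "finite S \<Longrightarrow> (\<Prod>q\<in>S. if P q then -1 else (1::complex)) = (if odd (card {q \<in> S. P q}) then -1 else 1)"
  by (simp add: prod.If_cases minus_one_power_iff flip: Collect_conj_eq) (simp add: Int_def)

text \<open>The layers copy each bit to all terms that use it, compute each parity by a fan-out
  whose direction is reversed by Hadamard gates, apply one phase gate per term, and undo the
  computation. Every term owns its copies, so terms do not collide and the depth is 9 whatever their
  number.\<close>

lemma implementable_parity_phase_lessThan:
  fixes S :: "nat \<Rightarrow> nat set" and \<theta> :: "nat \<Rightarrow> real"
  assumes S: "\<And>a. a < A \<Longrightarrow> S a \<subseteq> {..<N}"
  shows "implementable N 9 (10 * (\<Sum>a<A. card (S a) + 1))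
    (diag (\<lambda>y. \<Prod>a<A. if parity (S a) y then cis (\<theta> a) else 1))"
proof -
  \<comment> \<open>qubit \<open>cop a q\<close> is the copy of \<open>q\<close> for term \<open>a\<close>, and \<open>p a\<close> receives the parity of term \<open>a\<close>\<close>
  define cop where "cop a q = N * (a + 1) + q" for a q
  define p where "p a = N * (A + 1) + a" for a
  define Cs where "Cs = (\<Union>a<A. cop a ` S a)"
  define Ps where "Ps = p ` {..<A}"
  define Qs where "Qs = (\<Union>a<A. S a)"
  define T where "T q = {cop a q |a. a < A \<and> q \<in> S a}" for q
  have finS: "finite (S a)" if "a < A" for a
    using S[OF that] finite_subset by blast
  have cop_div: "cop a q div N = a + 1" and cop_mod: "cop a q mod N = q" if "q < N" for a q
    using that by (simp_all add: cop_def del: mult_Suc_right)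
  have cop_less: "cop a q < N * (A + 1)" if "a < A" "q < N" for a q
  proof -
    have "cop a q < N * (a + 2)" using that by (simp add: cop_def)
    also have "\<dots> \<le> N * (A + 1)" using that by (intro mult_le_mono2) simp
    finally show ?thesis .
  qed
  have cop_ge: "N \<le> cop a q" for a q by (simp add: cop_def)
  have p_inj: "inj p" by (simp add: p_def inj_def)
  have cop_inj: "inj_on (cop a) (S a)" for a by (simp add: cop_def inj_on_def)
  have Cs_less: "N \<le> i \<and> i < N * (A + 1)" if "i \<in> Cs" for i
    using that cop_less cop_ge S by (fastforce simp: Cs_def)
  have p_ge: "N * (A + 1) \<le> p a" for a by (simp add: p_def)
  have finC: "finite Cs" and finP: "finite Ps" and finQ: "finite Qs"
    using finS by (auto simp: Cs_def Ps_def Qs_def)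
  have disj: "Cs \<inter> Ps = {}" 
  proof -
    have "i \<notin> Ps" if "i \<in> Cs" for i
      using Cs_less[OF that] p_ge unfolding Ps_def by (metis imageE leD)
    then show ?thesis by blast
  qed
  have QN: "Qs \<subseteq> {..<N}" using S by (auto simp: Qs_def)
  have T_C: "(\<Union>q\<in>Qs. T q) = Cs" by (auto simp: T_def Cs_def Qs_def)
  have T_ge: "N \<le> t" if "t \<in> T q" for t q using that cop_ge by (auto simp: T_def)
  have T_mod: "t mod N = q" if "t \<in> T q" "q < N" for t q
    using that cop_mod by (auto simp: T_def)
  have cop_in_C: "a < A \<Longrightarrow> q \<in> S a \<Longrightarrow> cop a q \<in> Cs" for a q by (auto simp: Cs_def)
  have cardC: "card Cs \<le> (\<Sum>a<A. card (S a))"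
  proof -
    have "card Cs \<le> (\<Sum>a<A. card (cop a ` S a))" unfolding Cs_def by (rule card_UN_le) simp
    then show ?thesis using cop_inj by (simp add: card_image)
  qed
  have cardQ: "card Qs \<le> (\<Sum>a<A. card (S a))" unfolding Qs_def by (rule card_UN_le) simp
  have cardP: "card Ps \<le> A" unfolding Ps_def using card_image_le[of "{..<A}" p] by simp

  let ?D = "\<lambda>y. \<Prod>a<A. if parity (S a) y then cis (\<theta> a) else 1"
  define L1 where "L1 = map (\<lambda>q. FanOut q (T q)) (sorted_list_of_set Qs)"
  define LH where "LH = map (OneQubit had_matrix) (sorted_list_of_set (Cs \<union> Ps))"
  \<comment> \<open>The bound variable is the parity qubit; subtracting \<open>N * (A + 1)\<close>
    gives the index of its term. The parity qubit is the source here, and becomes the target only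
    through the Hadamard layers around \<open>LF\<close>.\<close>
  define LF where "LF = map (\<lambda>a. FanOut a (cop (a - N * (A + 1)) ` S (a - N * (A + 1)))) (sorted_list_of_set Ps)"
  define LP where "LP = map (\<lambda>a. OneQubit (phase_matrix (\<theta> a)) (p a)) [0..<A]"
  let ?C = "[L1, LH, LF, LH, LP, LH, LF, LH, L1]"
  \<comment> \<open>\<open>N * A\<close> ancillas reserve a full block of copies for each term and
    \<open>A\<close> hold the parities. Copies that no term needs are never touched and add nothing
    to the size.\<close>
  have "implements N e 9 (10 * (\<Sum>a<A. card (S a) + 1)) (diag ?D) ?C" if e: "e \<ge> N * A + A" for e
  proof -
    let ?N = "N + e"
    have le: "N * (A + 1) + A \<le> ?N" using e by simp
    have C_N: "Cs \<subseteq> {..<?N}" using Cs_less le by fastforce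
    have P_N: "Ps \<subseteq> {..<?N}" using le by (auto simp: Ps_def p_def)
    have T_N: "T q \<subseteq> {..<?N}" if "q \<in> Qs" for q using that T_C C_N by blast
    have lay1: "layer_on ?N L1"
      unfolding L1_def
    proof (rule layer_on_map)
      fix q assume q: "q \<in> set (sorted_list_of_set Qs)"
      then have "q < N" "q \<in> Qs" using finQ QN by auto
      moreover have "q \<notin> T q" using T_ge[of q q] \<open>q < N\<close> by auto
      ultimately show "proper_gate (FanOut q (T q)) \<and> gate_qubits (FanOut q (T q)) \<subseteq> {..<?N}"
        using T_N by auto
    next
      fix q q' assume q: "q \<in> set (sorted_list_of_set Qs)" "q' \<in> set (sorted_list_of_set Qs)"
        and ne: "q \<noteq> q'"
      have "q < N" "q' < N" using q finQ QN by auto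
      then have "q \<notin> T q'" "q' \<notin> T q"
        using T_ge by (auto simp: not_less[symmetric])
      moreover have "T q \<inter> T q' = {}"
        using T_mod[OF _ \<open>q < N\<close>] T_mod[OF _ \<open>q' < N\<close>] ne by (metis disjoint_iff)
      ultimately show "gate_qubits (FanOut q (T q)) \<inter> gate_qubits (FanOut q' (T q')) = {}"
        using ne by auto
    qed simp
    have layH: "layer_on ?N LH"
      unfolding LH_def
      by (rule layer_on_map) (use finC finP C_N P_N in \<open>auto simp: unitary2_had\<close>)
    have sub: "cop a ` S a \<subseteq> Cs" if "a < A" for a using that by (auto simp: Cs_def)
    have layF: "layer_on ?N LF"
      unfolding LF_def
    proof (rule layer_on_map)
      fix s assume "s \<in> set (sorted_list_of_set Ps)"
      then obtain a where a: "a < A" "s = p a" "s \<in> Ps" using finP by (auto simp: Ps_def)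
      moreover from a have "s \<notin> Cs" using disj by blast
      ultimately show "proper_gate (FanOut s (cop (s - N * (A + 1)) ` S (s - N * (A + 1)))) \<and>
          gate_qubits (FanOut s (cop (s - N * (A + 1)) ` S (s - N * (A + 1)))) \<subseteq> {..<?N}"
        using sub[OF a(1)] C_N P_N by (auto simp: p_def)
    next
      fix s s' assume s: "s \<in> set (sorted_list_of_set Ps)" "s' \<in> set (sorted_list_of_set Ps)"
        and ne: "s \<noteq> s'"
      obtain a a' where a: "a < A" "s = p a" "a' < A" "s' = p a'" "s \<in> Ps" "s' \<in> Ps" "a \<noteq> a'"
        using s ne finP by (auto simp: Ps_def)
      have "cop a q \<noteq> cop a' q'" if "q \<in> S a" "q' \<in> S a'" for q q'
      proof -
        have "q < N" "q' < N" using that S a by auto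
        then show ?thesis using cop_div[of q a] cop_div[of q' a'] a(7) by auto
      qed
      then have "cop a ` S a \<inter> cop a' ` S a' = {}" by auto
      moreover have "s \<notin> cop a' ` S a'" "s' \<notin> cop a ` S a"
        using a sub disj by blast+
      ultimately show "gate_qubits (FanOut s (cop (s - N * (A + 1)) ` S (s - N * (A + 1)))) \<inter>
          gate_qubits (FanOut s' (cop (s' - N * (A + 1)) ` S (s' - N * (A + 1)))) = {}"
        using ne a by (auto simp: p_def)
    qed simp
    have layP: "layer_on ?N LP"
      unfolding LP_def
      by (rule layer_on_map) (use P_N in \<open>auto simp: unitary2_phase Ps_def p_def\<close>)
    have size: "circuit_size ?C \<le> 10 * (\<Sum>a<A. card (S a) + 1)"
    proof -
      let ?s = "\<Sum>a<A. card (S a)"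
      have "(\<Sum>g\<leftarrow>L1. gate_size g) \<le> ?s + ?s"
      proof (rule layer_size_le[OF lay1])
        show "card (Qs \<union> Cs) \<le> ?s + ?s" using card_Un_le[of Qs Cs] cardC cardQ by linarith
      qed (use finQ finC T_C in \<open>auto simp: L1_def\<close>)
      moreover have "(\<Sum>g\<leftarrow>LH. gate_size g) \<le> ?s + A"
      proof (rule layer_size_le[OF layH])
        show "card (Cs \<union> Ps) \<le> ?s + A" using card_Un_le[of Cs Ps] cardC cardP by linarith
      qed (use finP finC in \<open>auto simp: LH_def\<close>)
      moreover have "(\<Sum>g\<leftarrow>LF. gate_size g) \<le> ?s + A"
      proof (rule layer_size_le[OF layF])
        show "card (Cs \<union> Ps) \<le> ?s + A" using card_Un_le[of Cs Ps] cardC cardP by linarith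
        show "gate_qubits g \<subseteq> Cs \<union> Ps" if g: "g \<in> set LF" for g
        proof -
          obtain a where "a < A" "g = FanOut (p a) (cop a ` S a)" "p a \<in> Ps"
            using g finP by (auto simp: LF_def Ps_def p_def)
          then show ?thesis using sub by auto
        qed
      qed (use finP finC in auto)
      moreover have "(\<Sum>g\<leftarrow>LP. gate_size g) \<le> A"
        by (rule layer_size_le[OF layP _ finP cardP]) (auto simp: LP_def Ps_def)
      \<comment> \<open>\<open>L1\<close> occurs twice, \<open>LH\<close> four times,
        \<open>LF\<close> twice and \<open>LP\<close> once: 4 + 4 + 2 = 10 times the set sizes and 4
        + 2 + 1 = 7 times \<open>A\<close>.\<close>
      ultimately have "circuit_size ?C \<le> 10 * ?s + 7 * A" by (simp add: circuit_size_def)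
      moreover have "(\<Sum>a<A. card (S a) + 1) = ?s + A" by (simp only: sum.distrib) simp
      ultimately show ?thesis by linarith
    qed
    let ?f1 = "flips Cs (\<lambda>i y. y ! (i mod N))"
    let ?g2 = "\<lambda>i y. odd (card {q \<in> S (i - N * (A + 1)). y ! cop (i - N * (A + 1)) q})"
    let ?f2 = "flips Ps ?g2"
    have run1: "fold (apply_gate ?N) L1 \<psi> = (\<lambda>y. \<psi> (?f1 y))" if \<psi>: "\<psi> \<in> qspace ?N" for \<psi>
    proof -
      have "fold (apply_gate ?N) L1 \<psi> =
          (\<lambda>y. \<psi> (flips (\<Union>s\<in>set (sorted_list_of_set Qs). T s) (\<lambda>i y. y ! (i mod N)) y))"
        unfolding L1_def
      proof (rule fan_layer[OF _ _ \<psi>])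
        show "set (sorted_list_of_set Qs) \<inter> T q = {}" for q
          using finQ QN T_ge by (auto simp: not_less[symmetric])
        show "t < ?N \<and> t mod N = q" if "q \<in> set (sorted_list_of_set Qs)" "t \<in> T q" for q t
          using that finQ QN T_N cop_mod by (auto simp: T_def)
      qed (use finQ QN in auto)
      then show ?thesis using T_C finQ by simp
    qed
    have runF: "fold (apply_gate ?N) LF \<psi> = (\<lambda>y. \<psi> (flips Cs (\<lambda>i y. y ! p (i div N - 1)) y))"
      if \<psi>: "\<psi> \<in> qspace ?N" for \<psi>
    proof -
      let ?T = "\<lambda>s. cop (s - N * (A + 1)) ` S (s - N * (A + 1))"
      have "fold (apply_gate ?N) LF \<psi> =
          (\<lambda>y. \<psi> (flips (\<Union>s\<in>set (sorted_list_of_set Ps). ?T s) (\<lambda>i y. y ! p (i div N - 1)) y))"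
        unfolding LF_def
      proof (rule fan_layer[OF _ _ \<psi>])
        fix s assume "s \<in> set (sorted_list_of_set Ps)"
        then obtain a where a: "a < A" "s = p a" using finP by (auto simp: Ps_def)
        then have T: "?T s = cop a ` S a" by (simp add: p_def)
        show "set (sorted_list_of_set Ps) \<inter> ?T s = {}"
          using sub[OF a(1)] disj finP unfolding T by auto
        show "t < ?N \<and> p (t div N - 1) = s" if "t \<in> ?T s" for t
          using that a S[OF a(1)] sub[OF a(1)] C_N cop_div unfolding T by auto
      qed (use finP P_N in auto)
      moreover have "(\<Union>s\<in>set (sorted_list_of_set Ps). ?T s) = Cs"
        using finP by (auto simp: Ps_def Cs_def p_def)
      ultimately show ?thesis by simp
    qed
    have runH: "fold (apply_gate ?N) LH \<psi> = Had (Cs \<union> Ps) \<psi>" for \<psi>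
      unfolding LH_def using finC finP by (subst had_layer) auto
    \<comment> \<open>A fan-out is a product of controlled signs conjugated by Hadamard gates on its
      targets. The outer Hadamard gates on \<open>Cs\<close> cancel these, and those on
      \<open>Ps\<close> remain. The signs are symmetric in source and target, so now the copies
      control the parity qubits.\<close>
    have mid: "fold (apply_gate ?N) LH (fold (apply_gate ?N) LF (fold (apply_gate ?N) LH \<psi>)) =
        (\<lambda>y. \<psi> (?f2 y))" if \<psi>: "\<psi> \<in> qspace ?N" for \<psi>
    proof -
      let ?c1 = "\<lambda>i y. if y ! p (i div N - 1) then -1 else (1::complex)"
      let ?c2 = "\<lambda>i y. if ?g2 i y then -1 else (1::complex)"
      have neC: "p a \<notin> Cs" if "a < A" for a using that disj by (auto simp: Ps_def)
      have U: "Had (Cs \<union> Ps) \<chi> = Had Ps (Had Cs \<chi>)" for \<chi>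
        using Had_Un[of Ps Cs] finC finP disj by (simp add: Un_commute Int_commute)
      have U': "Had (Cs \<union> Ps) \<chi> = Had Cs (Had Ps \<chi>)" for \<chi>
        using Had_Un[of Cs Ps] finC finP disj by simp
      let ?\<chi> = "Had (Cs \<union> Ps) \<psi>"
      have "fold (apply_gate ?N) LF ?\<chi> = conj_phase ?c1 Cs ?\<chi>"
        unfolding runF[OF Had_qspace[OF \<psi>]]
      proof (rule conj_phase_flips[symmetric, OF finC C_N Had_qspace[OF \<psi>]])
        fix i i' :: nat and y :: "bool list" and b assume i: "i \<in> Cs" "i' \<in> Cs"
        then obtain a q where a: "a < A" "q \<in> S a" "i = cop a q" by (auto simp: Cs_def)
        then have "i div N - 1 = a" using S[OF a(1)] cop_div by auto
        moreover have "i' \<noteq> p a" using i neC[OF a(1)] by auto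
        ultimately show "y[i' := b] ! p (i div N - 1) = y ! p (i div N - 1)" by simp
      qed
      also have "\<dots> = Had Cs (diag (\<lambda>y. \<Prod>i\<in>Cs. bit_phase ?c1 i y) (Had Ps \<psi>))"
        unfolding conj_phase_def U'
        using Had_Had[OF finC C_N Had_qspace[OF \<psi>, of Ps]] by simp
      \<comment> \<open>Signs indexed by the copies are regrouped by parity qubit: the copies of
        term \<open>a\<close> together contribute the parity of their bits.\<close>
      also have "(\<lambda>y. \<Prod>i\<in>Cs. bit_phase ?c1 i y) = (\<lambda>y. \<Prod>i\<in>Ps. bit_phase ?c2 i y)"
      proof
        fix y
        have "(\<Prod>i\<in>Cs. bit_phase ?c1 i y) = (\<Prod>a<A. \<Prod>i\<in>cop a ` S a. bit_phase ?c1 i y)"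
          unfolding Cs_def
        proof (rule prod.UNION_disjoint)
          show "\<forall>a\<in>{..<A}. \<forall>a'\<in>{..<A}. a \<noteq> a' \<longrightarrow> cop a ` S a \<inter> cop a' ` S a' = {}"
          proof (intro ballI impI)
            fix a a' assume a: "a \<in> {..<A}" "a' \<in> {..<A}" "a \<noteq> a'"
            have "cop a q \<noteq> cop a' q'" if "q \<in> S a" "q' \<in> S a'" for q q'
            proof -
              have "q < N" "q' < N" using that S a by auto
              then show ?thesis using cop_div[of q a] cop_div[of q' a'] a(3) by auto
            qed
            then show "cop a ` S a \<inter> cop a' ` S a' = {}" by auto
          qed
        qed (use finS in auto)
        also have "\<dots> = (\<Prod>a<A. bit_phase ?c2 (p a) y)"
        proof (rule prod.cong[OF refl])
          fix a assume "a \<in> {..<A}"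
          then have a: "a < A" by simp
          have "(\<Prod>i\<in>cop a ` S a. bit_phase ?c1 i y) = (\<Prod>q\<in>S a. bit_phase ?c1 (cop a q) y)"
            by (simp add: prod.reindex[OF cop_inj])
          also have "\<dots> = (\<Prod>q\<in>S a. if y ! p a \<and> y ! cop a q then -1 else 1)"
            by (rule prod.cong[OF refl]) (use S[OF a] cop_div in \<open>auto simp: bit_phase_def\<close>)
          also have "\<dots> = bit_phase ?c2 (p a) y"
            by (subst prod_sign[OF finS[OF a]]) (simp add: bit_phase_def p_def)
          finally show "(\<Prod>i\<in>cop a ` S a. bit_phase ?c1 i y) = bit_phase ?c2 (p a) y" .
        qed
        also have "\<dots> = (\<Prod>i\<in>Ps. bit_phase ?c2 i y)"
          unfolding Ps_def by (subst prod.reindex) (use p_inj in \<open>auto simp: inj_def inj_on_def\<close>)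
        finally show "(\<Prod>i\<in>Cs. bit_phase ?c1 i y) = (\<Prod>i\<in>Ps. bit_phase ?c2 i y)" .
      qed
      finally have F: "fold (apply_gate ?N) LF ?\<chi> =
          Had Cs (diag (\<lambda>y. \<Prod>i\<in>Ps. bit_phase ?c2 i y) (Had Ps \<psi>))" .
      have "fold (apply_gate ?N) LH (fold (apply_gate ?N) LF (fold (apply_gate ?N) LH \<psi>)) =
          conj_phase ?c2 Ps \<psi>"
        unfolding runH F unfolding U conj_phase_def
        using Had_Had[OF finC C_N diag_qspace[OF Had_qspace[OF \<psi>]]] by simp
      also have "\<dots> = (\<lambda>y. \<psi> (?f2 y))"
      proof (rule conj_phase_flips[OF finP P_N \<psi>])
        fix i i' :: nat and y :: "bool list" and b assume i: "i \<in> Ps" "i' \<in> Ps"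
        then obtain a where a: "a < A" "i = p a" by (auto simp: Ps_def)
        have "y[i' := b] ! cop a q = y ! cop a q" if "q \<in> S a" for q
        proof -
          have "i' \<noteq> cop a q" using i(2) cop_in_C[OF a(1) that] disj by auto
          then show ?thesis by simp
        qed
        then have "{q \<in> S a. y[i' := b] ! cop a q} = {q \<in> S a. y ! cop a q}" by auto
        then show "?g2 i (y[i' := b]) = ?g2 i y" using a by (simp add: p_def)
      qed
      finally show ?thesis .
    qed
    have runP: "fold (apply_gate ?N) LP \<psi> = diag (\<lambda>y. \<Prod>a<A. if y ! p a then cis (\<theta> a) else 1) \<psi>" for \<psi>
      unfolding LP_def by (subst phase_layer) (simp_all add: atLeast0LessThan)
    have run: "run_circuit ?N ?C (with_zeros N e \<psi>) = with_zeros N e (diag ?D \<psi>)"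
      if \<psi>: "\<psi> \<in> qspace N" for \<psi>
    proof -
      let ?\<psi> = "with_zeros N e \<psi>"
      let ?\<phi> = "\<lambda>y. \<Prod>a<A. if y ! p a then cis (\<theta> a) else 1"
      have q0: "?\<psi> \<in> qspace ?N" by (rule with_zeros_qspace[OF \<psi>])
      have q1: "(\<lambda>y. ?\<psi> (?f1 y)) \<in> qspace ?N" by (rule pull_qspace[OF q0]) simp
      have q2: "(\<lambda>y. ?\<psi> (?f1 (?f2 y))) \<in> qspace ?N" by (rule pull_qspace[OF q1]) simp
      let ?\<psi>3 = "diag ?\<phi> (\<lambda>y. ?\<psi> (?f1 (?f2 y)))"
      have q3: "?\<psi>3 \<in> qspace ?N" by (rule diag_qspace[OF q2])
      have q4: "(\<lambda>y. ?\<psi>3 (?f2 y)) \<in> qspace ?N" by (rule pull_qspace[OF q3]) simp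
      have R: "run_circuit ?N ?C ?\<psi> = (\<lambda>y. ?\<psi>3 (?f2 (?f1 y)))"
        by (simp only: run_circuit_def fold.simps comp_apply id_apply
            run1[OF q0] mid[OF q1] runP mid[OF q3] run1[OF q4])
      show ?thesis
        unfolding R
      proof (rule qspace_eqI)
        show "(\<lambda>y. ?\<psi>3 (?f2 (?f1 y))) \<in> qspace ?N" by (rule pull_qspace[OF q4]) simp
        show "with_zeros N e (diag ?D \<psi>) \<in> qspace ?N"
          by (intro with_zeros_qspace diag_qspace \<psi>)
        fix y :: "bool list" assume y: "length y = ?N"
        have f1: "?f1 (?f1 y) = y"
        proof (rule flips_flips)
          fix i assume "i \<in> Cs"
          then obtain a q where "a < A" "q \<in> S a" "i = cop a q" by (auto simp: Cs_def)
          then have "q < N" "i mod N = q" using S cop_mod by auto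
          moreover have "q \<notin> Cs" using Cs_less \<open>q < N\<close> by fastforce
          ultimately show "?f1 y ! (i mod N) = y ! (i mod N)" using y by (simp add: nth_flips)
        qed
        have f2: "?f2 (?f2 z) = z" if z: "length z = ?N" for z
        proof (rule flips_flips)
          fix i assume "i \<in> Ps"
          then obtain a where a: "a < A" "i = p a" by (auto simp: Ps_def)
          have "?f2 z ! cop a q = z ! cop a q" if "q \<in> S a" for q
            using cop_in_C[OF a(1) that] disj C_N z by (subst nth_flips) auto
          then have "{q \<in> S a. ?f2 z ! cop a q} = {q \<in> S a. z ! cop a q}" by auto
          then show "?g2 i (?f2 z) = ?g2 i z" using a by (simp add: p_def)
        qed
        have eq: "?\<psi>3 (?f2 (?f1 y)) = ?\<phi> (?f2 (?f1 y)) * ?\<psi> y"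
          using f1 f2[of "?f1 y"] y by (simp add: diag_def)
        show "?\<psi>3 (?f2 (?f1 y)) = with_zeros N e (diag ?D \<psi>) y"
        proof (cases "drop N y = zeros e")
          case True
          let ?x = "take N y"
          have nth_x: "?x ! q = y ! q" if "q < N" for q using that by simp
          have nth_0: "\<not> y ! i" if "N \<le> i" "i < ?N" for i
            using that y arg_cong[OF True, of "\<lambda>l. l ! (i - N)"] by simp
          have "?f2 (?f1 y) ! p a \<longleftrightarrow> parity (S a) ?x" if a: "a < A" for a
          proof -
            have pa: "p a < ?N" "p a \<in> Ps" "p a \<notin> Cs" "N \<le> p a"
              using a P_N disj p_ge[of a] by (auto simp: Ps_def)
            have "?f1 y ! cop a q = ?x ! q" if "q \<in> S a" for q
            proof -
              have c: "cop a q \<in> Cs" "q < N" using cop_in_C[OF a that] S[OF a] that by auto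
              then have "cop a q < ?N" using C_N by auto
              then show ?thesis using c nth_0[OF cop_ge, of a q] cop_mod y by (simp add: nth_flips)
            qed
            then have *: "{q \<in> S a. ?f1 y ! cop a q} = {q \<in> S a. ?x ! q}" by auto
            show ?thesis
              using pa nth_0[of "p a"] y * by (simp add: nth_flips parity_def p_def)
          qed
          then have "?\<phi> (?f2 (?f1 y)) = ?D ?x"
            by (intro prod.cong) auto
          then show ?thesis using True y eq by (simp add: with_zeros_apply diag_def)
        qed (use y eq in \<open>simp add: with_zeros_apply\<close>)
      qed
    qed
    show ?thesis
      using lay1 layH layF layP size run
      by (simp add: implements_def circuit_on_def circuit_depth_def)
  qed
  then show ?thesis
    unfolding implementable_def using diag_qspace by blast
qed


section \<open>Phases of conjunctions\<close>

lemma implementable_parity_phase: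
  fixes S :: "'i \<Rightarrow> nat set" and \<theta> :: "'i \<Rightarrow> real"
  assumes I: "finite I" and S: "\<And>a. a \<in> I \<Longrightarrow> S a \<subseteq> {..<N}"
  shows "implementable N 9 (10 * (\<Sum>a\<in>I. card (S a) + 1))
    (diag (\<lambda>y. \<Prod>a\<in>I. if parity (S a) y then cis (\<theta> a) else 1))"
proof -
  obtain h where h: "bij_betw h {..<card I} I"
    using ex_bij_betw_nat_finite[OF I] by (auto simp: atLeast0LessThan)
  have "implementable N 9 (10 * (\<Sum>a<card I. card (S (h a)) + 1))
      (diag (\<lambda>y. \<Prod>a<card I. if parity (S (h a)) y then cis (\<theta> (h a)) else 1))"
    by (rule implementable_parity_phase_lessThan) (use S h in \<open>auto simp: bij_betw_def\<close>)
  moreover have "(\<Sum>a<card I. card (S (h a)) + 1) = (\<Sum>a\<in>I. card (S a) + 1)"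
    by (rule sum.reindex_bij_betw[OF h])
  moreover have "(\<Prod>a<card I. if parity (S (h a)) y then cis (\<theta> (h a)) else 1) =
      (\<Prod>a\<in>I. if parity (S a) y then cis (\<theta> a) else 1)" for y
    by (rule prod.reindex_bij_betw[OF h])
  ultimately show ?thesis by simp
qed

lemma cis_sum: "cis (\<Sum>a\<in>I. f a) = (\<Prod>a\<in>I. cis (f a))"
  by (induction I rule: infinite_finite_induct) (simp_all flip: cis_mult)

text \<open>With signs \<chi> = 1, -1 for the bits 0, 1, the conjunction times 2^|S| is the product
  of the factors 1 - \<chi>. Expanding it gives the sign products over all subsets \<open>B\<close>,
  each of which is 1 - 2 \<open>parity\<close>. The constant part is an alternating sum over the
  subsets and vanishes since \<open>S\<close> is nonempty.\<close>

lemma and_eq_parity_sum: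
  assumes "finite S" "S \<noteq> {}"
  shows "(\<Sum>B\<in>Pow S. if parity B y then (-1) ^ (card B + 1) else 0) =
    2 ^ (card S - 1) * (of_bool (\<forall>q\<in>S. y ! q) :: real)"
proof -
  let ?\<chi> = "\<lambda>q. if y ! q then -1 else (1::real)"
  have c: "0 < card S" using assms by (simp add: card_gt_0_iff)
  have \<chi>: "(\<Prod>q\<in>B. - ?\<chi> q) = (-1) ^ card B * (if parity B y then -1 else 1)" if "B \<subseteq> S" for B
  proof -
    have fin: "finite B" using that assms finite_subset by blast
    have "(\<Prod>q\<in>B. - ?\<chi> q) = (-1) ^ card B * (\<Prod>q\<in>B. ?\<chi> q)"
      using fin by (induction B rule: finite_induct) (auto simp: mult_ac)
    also have "(\<Prod>q\<in>B. ?\<chi> q) = (if parity B y then -1 else 1)"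
      using fin by (simp add: parity_def prod.If_cases minus_one_power_iff) (simp add: Int_def)
    finally show ?thesis .
  qed
  have "0 = (\<Prod>q\<in>S. (-1) + (1::real))" using c by simp
  also have "\<dots> = (\<Sum>B\<in>Pow S. (-1) ^ card B)" by (subst prod_add) (simp_all add: assms)
  finally have 1: "(\<Sum>B\<in>Pow S. (-1) ^ card B) = (0::real)" by simp
  have "2 ^ card S * of_bool (\<forall>q\<in>S. y ! q) = (\<Prod>q\<in>S. - ?\<chi> q + 1)"
  proof (cases "\<forall>q\<in>S. y ! q")
    case False
    then show ?thesis using assms by (auto intro!: prod_zero[symmetric])
  qed simp
  also have "\<dots> = (\<Sum>B\<in>Pow S. (-1) ^ card B * (if parity B y then -1 else 1))"
    by (subst prod_add[OF assms(1)]) (auto intro!: sum.cong simp: \<chi>)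
  finally have 2: "(\<Sum>B\<in>Pow S. (-1) ^ card B * (if parity B y then -1 else 1)) =
      (2 ^ card S * of_bool (\<forall>q\<in>S. y ! q) :: real)" by simp
  have "(\<Sum>B\<in>Pow S. if parity B y then (-1) ^ (card B + 1) else (0::real)) =
      (\<Sum>B\<in>Pow S. ((-1) ^ card B * (if parity B y then -1 else 1) - (-1) ^ card B) / 2)"
    by (rule sum.cong) auto
  also have "\<dots> = 2 ^ card S * of_bool (\<forall>q\<in>S. y ! q) / 2"
    by (simp only: sum_divide_distrib[symmetric] sum_subtractf 1 2) simp
  also have "card S = Suc (card S - 1)" using c by simp
  finally show ?thesis by (simp del: of_bool_eq_1_iff of_bool_eq_0_iff)
qed

lemma cis_and:
  assumes "finite S" "S \<noteq> {}"
  shows "cis (\<theta> * of_bool (\<forall>q\<in>S. y ! q)) =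
    (\<Prod>B\<in>Pow S. if parity B y then cis (\<theta> / 2 ^ (card S - 1) * (-1) ^ (card B + 1)) else 1)"
proof -
  have "\<theta> * of_bool (\<forall>q\<in>S. y ! q) =
      \<theta> / 2 ^ (card S - 1) * (\<Sum>B\<in>Pow S. if parity B y then (-1) ^ (card B + 1) else 0)"
    unfolding and_eq_parity_sum[OF assms] by simp
  also have "cis \<dots> = (\<Prod>B\<in>Pow S. cis (\<theta> / 2 ^ (card S - 1) * (if parity B y then (-1) ^ (card B + 1) else 0)))"
    by (simp only: sum_distrib_left cis_sum)
  also have "\<dots> = (\<Prod>B\<in>Pow S. if parity B y then cis (\<theta> / 2 ^ (card S - 1) * (-1) ^ (card B + 1)) else 1)"
    by (rule prod.cong) auto
  finally show ?thesis .
qed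

text \<open>Every subset of \<open>S a\<close> becomes a parity term, whence the factor
  \<open>2 ^ card (S a)\<close>. Later uses keep the sets small: one or two bits, or one bit more
  than the number of tests of a candidate.\<close>

lemma implementable_and_phase:
  fixes S :: "'i \<Rightarrow> nat set" and \<theta> :: "'i \<Rightarrow> real"
  assumes I: "finite I" and S: "\<And>a. a \<in> I \<Longrightarrow> S a \<subseteq> {..<N} \<and> S a \<noteq> {}"
  shows "implementable N 9 (10 * (\<Sum>a\<in>I. 2 ^ card (S a) * (card (S a) + 1)))
    (diag (\<lambda>y. cis (\<Sum>a\<in>I. \<theta> a * of_bool (\<forall>q\<in>S a. y ! q))))"
proof -
  have fin: "finite (S a)" if "a \<in> I" for a using S[OF that] finite_subset by blast
  let ?J = "SIGMA a:I. Pow (S a)"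
  let ?\<theta> = "\<lambda>(a, B). \<theta> a / 2 ^ (card (S a) - 1) * (-1) ^ (card B + 1)"
  have "implementable N 9 (10 * (\<Sum>j\<in>?J. card (snd j) + 1))
      (diag (\<lambda>y. \<Prod>j\<in>?J. if parity (snd j) y then cis (?\<theta> j) else 1))"
  proof (rule implementable_parity_phase)
    show "snd j \<subseteq> {..<N}" if "j \<in> ?J" for j
      using that S by (cases j) (simp, blast)
  qed (use I fin in auto)
  moreover have "(\<Prod>j\<in>?J. if parity (snd j) y then cis (?\<theta> j) else 1) =
      cis (\<Sum>a\<in>I. \<theta> a * of_bool (\<forall>q\<in>S a. y ! q))" for y
  proof -
    have "(\<Prod>j\<in>?J. if parity (snd j) y then cis (?\<theta> j) else 1) =
        (\<Prod>a\<in>I. \<Prod>B\<in>Pow (S a). if parity B y then cis (\<theta> a / 2 ^ (card (S a) - 1) * (-1) ^ (card B + 1)) else 1)"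
      by (subst prod.Sigma) (auto simp: I fin case_prod_beta intro!: prod.cong)
    also have "\<dots> = (\<Prod>a\<in>I. cis (\<theta> a * of_bool (\<forall>q\<in>S a. y ! q)))"
      by (rule prod.cong[OF refl], rule cis_and[symmetric]) (use S fin in auto)
    finally show ?thesis by (simp only: cis_sum)
  qed
  moreover have "(\<Sum>j\<in>?J. card (snd j) + 1) \<le> (\<Sum>a\<in>I. 2 ^ card (S a) * (card (S a) + 1))"
  proof -
    have "(\<Sum>j\<in>?J. card (snd j) + 1) = (\<Sum>a\<in>I. \<Sum>B\<in>Pow (S a). card B + 1)"
      by (subst sum.Sigma) (auto simp: I fin case_prod_beta intro!: sum.cong)
    also have "\<dots> \<le> (\<Sum>a\<in>I. \<Sum>B\<in>Pow (S a). card (S a) + 1)"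
      by (intro sum_mono) (use fin in \<open>auto intro: card_mono\<close>)
    also have "\<dots> = (\<Sum>a\<in>I. 2 ^ card (S a) * (card (S a) + 1))"
      by (rule sum.cong) (simp_all add: card_Pow fin)
    finally show ?thesis .
  qed
  ultimately show ?thesis by (auto intro: implementable_mono)
qed

section \<open>Weighted sums of bits and the test phases\<close>

definition lin :: "nat set \<Rightarrow> (nat \<Rightarrow> real) \<Rightarrow> bool list \<Rightarrow> real" where
  "lin X \<gamma> y = (\<Sum>i\<in>X. \<gamma> i * of_bool (y ! i))"

text \<open>
  The test of candidate \<open>t\<close> at level \<open>j\<close> sits on qubit \<open>N + t * \<mu> + j\<close>.
\<close>

definition test_angle :: "nat \<Rightarrow> nat \<Rightarrow> real \<Rightarrow> nat \<Rightarrow> real" where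
  "test_angle N \<mu> f q = 2 * pi * ((f - real ((q - N) div \<mu>)) / 2 ^ ((q - N) mod \<mu> + 1) + 1 / 2)"

text \<open>The product of the controlled phases of all tests, kept as a single exponent so that it
  can be regrouped by input bits later.\<close>

definition test_phase :: "nat \<Rightarrow> nat \<Rightarrow> nat set \<Rightarrow> (nat \<Rightarrow> real) \<Rightarrow> bool list \<Rightarrow> complex" where
  "test_phase N \<mu> X \<gamma> y =
     cis (\<Sum>q\<in>{N..<N + 2 ^ \<mu> * \<mu>}. of_bool (y ! q) * test_angle N \<mu> (lin X \<gamma> y) q)"

text \<open>For the right candidate, k - t is a multiple of every 2^(j+1) in range and the summand
  1/2 gives -1. For a wrong one, some level sees an odd multiple of 2^j, which contributes another
  1/2 and completes a full turn.\<close>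

lemma cis_test_angle:
  fixes k t \<mu> :: nat
  assumes "t < 2 ^ \<mu>"
  shows "t = k mod 2 ^ \<mu> \<Longrightarrow> j < \<mu> \<Longrightarrow> cis (2 * pi * ((real k - real t) / 2 ^ (j + 1) + 1 / 2)) = -1"
    and "t \<noteq> k mod 2 ^ \<mu> \<Longrightarrow> \<exists>j<\<mu>. cis (2 * pi * ((real k - real t) / 2 ^ (j + 1) + 1 / 2)) = 1"
proof -
  assume t: "t = k mod 2 ^ \<mu>" and j: "j < \<mu>"
  have "k = t + 2 ^ \<mu> * (k div 2 ^ \<mu>)" using t by simp
  from arg_cong[OF this, of real] have "real k - real t = 2 ^ \<mu> * real (k div 2 ^ \<mu>)"
    by (simp only: of_nat_add of_nat_mult of_nat_power of_nat_numeral add_diff_cancel_left')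
  also have "(2::real) ^ \<mu> = 2 ^ (\<mu> - (j + 1)) * 2 ^ (j + 1)"
  proof -
    have "\<mu> = (\<mu> - (j + 1)) + (j + 1)" using j by simp
    from arg_cong[OF this, of "\<lambda>n. (2::real) ^ n"] show ?thesis by (simp only: power_add)
  qed
  finally have "(real k - real t) / 2 ^ (j + 1) = real (2 ^ (\<mu> - (j + 1)) * (k div 2 ^ \<mu>))"
    by simp
  then have "2 * pi * ((real k - real t) / 2 ^ (j + 1) + 1 / 2) =
      2 * pi * real (2 ^ (\<mu> - (j + 1)) * (k div 2 ^ \<mu>)) + pi"
    by (simp add: distrib_left)
  then have "cis (2 * pi * ((real k - real t) / 2 ^ (j + 1) + 1 / 2)) =
      cis (2 * pi * real (2 ^ (\<mu> - (j + 1)) * (k div 2 ^ \<mu>))) * cis pi"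
    by (simp only: cis_mult)
  also have "cis (2 * pi * real (2 ^ (\<mu> - (j + 1)) * (k div 2 ^ \<mu>))) = 1"
    by (rule cis_multiple_2pi) simp
  finally show "cis (2 * pi * ((real k - real t) / 2 ^ (j + 1) + 1 / 2)) = -1" by simp
next
  assume t: "t \<noteq> k mod 2 ^ \<mu>"
  define d where "d = int k - int t"
  have nd: "\<not> 2 ^ \<mu> dvd d"
  proof
    assume "2 ^ \<mu> dvd d"
    then have "int k mod 2 ^ \<mu> = int t mod 2 ^ \<mu>" by (simp add: d_def mod_eq_dvd_iff)
    then have "int (k mod 2 ^ \<mu>) = int (t mod 2 ^ \<mu>)" by (simp add: zmod_int)
    then have "k mod 2 ^ \<mu> = t mod 2 ^ \<mu>" by (simp only: of_nat_eq_iff)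
    then show False using t assms by simp
  qed
  then have "\<mu> \<noteq> 0" by (intro notI) simp
  then have ex: "\<not> 2 ^ Suc (\<mu> - 1) dvd d" using nd by simp
  \<comment> \<open>\<open>j\<close> is the 2-adic valuation of the difference, which is taken in
    \<open>int\<close> because \<open>t\<close> may exceed \<open>k\<close>.\<close>
  define j where "j = (LEAST j. \<not> 2 ^ Suc j dvd d)"
  have j: "\<not> 2 ^ Suc j dvd d" unfolding j_def by (rule LeastI[of _ "\<mu> - 1"]) (rule ex)
  have "j \<le> \<mu> - 1" unfolding j_def by (rule Least_le) (rule ex)
  then have j\<mu>: "j < \<mu>" using \<open>\<mu> \<noteq> 0\<close> by simp
  have "2 ^ j dvd d"
  proof (cases j)
    case (Suc i)
    then have "i < (LEAST j. \<not> 2 ^ Suc j dvd d)" by (simp add: j_def)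
    from not_less_Least[OF this] show ?thesis unfolding Suc by blast
  qed simp
  then obtain m where m: "d = 2 ^ j * m" by blast
  then have "odd m" using j by auto
  then obtain n where n: "m = 2 * n + 1" by (rule oddE)
  have "real k - real t = real_of_int d" by (simp add: d_def)
  also have "\<dots> = 2 ^ j * (2 * of_int n + 1)" by (simp add: m n)
  finally have "(real k - real t) / 2 ^ (j + 1) + 1 / 2 = of_int (n + 1)"
    by (simp add: field_simps)
  then have "cis (2 * pi * ((real k - real t) / 2 ^ (j + 1) + 1 / 2)) = 1"
    by (simp only:) (rule cis_multiple_2pi, simp)
  then show "\<exists>j<\<mu>. cis (2 * pi * ((real k - real t) / 2 ^ (j + 1) + 1 / 2)) = 1"
    using j\<mu> by blast
qed


section \<open>Reading off binary digits\<close>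

lemma diag_cong_supp: "(\<And>y. \<psi> y \<noteq> 0 \<Longrightarrow> \<phi> y = \<chi> y) \<Longrightarrow> diag \<phi> \<psi> = diag \<chi> \<psi>"
  by (auto simp: diag_def fun_eq_iff)

text \<open>Projecting onto \<open>P\<close> is a diagonal operator that ignores the qubits of
  \<open>Q\<close>, so it commutes with their Hadamard gates.\<close>

lemma Had_support:
  assumes "finite Q" "\<And>y q b. q \<in> Q \<Longrightarrow> P (y[q := b]) = P y"
    and "\<And>y. \<psi> y \<noteq> 0 \<Longrightarrow> P y" and "Had Q \<psi> y \<noteq> 0"
  shows "P y"
proof -
  have "diag (\<lambda>y. of_bool (P y)) \<psi> = \<psi>" using assms(3) by (auto simp: diag_def fun_eq_iff)
  then have "Had Q \<psi> = diag (\<lambda>y. of_bool (P y)) (Had Q \<psi>)"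
    using Had_diag[OF assms(1), of "\<lambda>y. of_bool (P y)" \<psi>] assms(2) by simp
  then have "Had Q \<psi> y = of_bool (P y) * Had Q \<psi> y" by (metis diag_def)
  then show ?thesis using assms(4) by auto
qed

text \<open>This lets the written output pass through the Hadamard gates on the test qubits, once it
  is known to be a constant flip.\<close>

lemma Had_flips_const:
  assumes "finite Q" "Q \<subseteq> {..<N}" "Q \<inter> Z = {}" "\<psi> \<in> qspace N"
  shows "Had Q (\<lambda>y. \<psi> (flips Z (\<lambda>i _. v i) y)) = (\<lambda>y. Had Q \<psi> (flips Z (\<lambda>i _. v i) y))"
  using assms(1-3)
proof (induction Q rule: finite_induct)
  case (insert q Q)
  let ?f = "flips Z (\<lambda>i _. v i)"
  have IH: "Had Q (\<lambda>y. \<psi> (?f y)) = (\<lambda>y. Had Q \<psi> (?f y))"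
    using insert by auto
  have q: "Had Q \<psi> \<in> qspace N" by (rule Had_qspace[OF assms(4)])
  have "had q (\<lambda>y. Had Q \<psi> (?f y)) = (\<lambda>y. had q (Had Q \<psi>) (?f y))"
  proof (rule qspace_eqI)
    show "had q (\<lambda>y. Had Q \<psi> (?f y)) \<in> qspace N"
      by (rule had_qspace, rule pull_qspace[OF q]) simp
    show "(\<lambda>y. had q (Had Q \<psi>) (?f y)) \<in> qspace N"
      by (rule pull_qspace[OF had_qspace[OF q]]) simp
    fix y :: "bool list" assume y: "length y = N"
    have qN: "q < length y" "q \<notin> Z" using insert.prems y by auto
    have "?f (y[q := b]) = (?f y)[q := b]" for b
      by (rule nth_equalityI) (use qN in \<open>auto simp: nth_flips nth_list_update\<close>)
    moreover have "?f y ! q = y ! q" using qN by (simp add: nth_flips)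
    ultimately show "had q (\<lambda>y. Had Q \<psi> (?f y)) y = had q (Had Q \<psi>) (?f y)"
      by (simp add: had_def)
  qed
  then show ?case using insert.hyps IH by (simp add: Had_insert)
qed simp

lemma flips_ket:
  assumes "length x = N"
  shows "(\<lambda>y. ket x (flips Z (\<lambda>i _. v i) y)) = ket (flips Z (\<lambda>i _. v i) x)"
proof
  fix y
  have ff: "flips Z (\<lambda>i _. v i) (flips Z (\<lambda>i _. v i) z) = z" for z
    by (rule flips_flips) simp
  have "flips Z (\<lambda>i _. v i) y = x \<longleftrightarrow> y = flips Z (\<lambda>i _. v i) x"
    using ff by (metis (full_types))
  then show "ket x (flips Z (\<lambda>i _. v i) y) = ket (flips Z (\<lambda>i _. v i) x) y"
    by (simp add: ket_def)
qed

text \<open>A sign for each conjunction of an output qubit with a set \<open>S t\<close> turns,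
  under Hadamard gates on the outputs, into an XOR of the conjunctions. In the application exactly
  one candidate passes on the relevant states, so the XOR reads off its digit;
  \<open>inv_into\<close> finds the digit that belongs to an output qubit.\<close>

lemma implementable_xor_and:
  fixes M :: nat and B :: "nat \<Rightarrow> nat \<Rightarrow> bool" and S :: "nat \<Rightarrow> nat set"
  assumes o: "inj_on out {..<\<mu>}" "out ` {..<\<mu>} \<subseteq> {..<N}"
    and S: "\<And>t. t < M \<Longrightarrow> S t \<subseteq> {..<N} \<and> S t \<inter> out ` {..<\<mu>} = {} \<and> card (S t) \<le> k"
  shows "implementable N 11 (2 * \<mu> + 10 * (\<mu> * (M * (2 ^ (k + 1) * (k + 2)))))
    (\<lambda>\<psi> y. \<psi> (flips (out ` {..<\<mu>})
       (\<lambda>i y. odd (card {t\<in>{t\<in>{..<M}. B t (inv_into {..<\<mu>} out i)}. \<forall>q\<in>S t. y ! q})) y))"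
proof -
  let ?O = "out ` {..<\<mu>}"
  let ?T = "\<lambda>b. {t\<in>{..<M}. B t b}"
  let ?J = "SIGMA b:{..<\<mu>}. ?T b"
  let ?g = "\<lambda>i y. odd (card {t\<in>?T (inv_into {..<\<mu>} out i). \<forall>q\<in>S t. y ! q})"
  let ?c = "\<lambda>i y. if ?g i y then -1 else (1::complex)"
  let ?S = "\<lambda>j. insert (out (fst j)) (S (snd j))"
  let ?\<phi> = "\<lambda>y. cis (\<Sum>j\<in>?J. pi * of_bool (\<forall>q\<in>?S j. y ! q))"
  have finO: "finite ?O" by simp
  have cardO: "card ?O \<le> \<mu>" using card_image_le[of "{..<\<mu>}" out] by simp
  have "implementable N 9 (10 * (\<Sum>j\<in>?J. 2 ^ card (?S j) * (card (?S j) + 1))) (diag ?\<phi>)"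
  proof (rule implementable_and_phase)
    fix j assume "j \<in> ?J"
    then have "snd j < M" "fst j < \<mu>" by auto
    then show "?S j \<subseteq> {..<N} \<and> ?S j \<noteq> {}" using S[of "snd j"] o(2) by auto
  qed simp
  moreover have "(\<Sum>j\<in>?J. 2 ^ card (?S j) * (card (?S j) + 1)) \<le> \<mu> * (M * (2 ^ (k + 1) * (k + 2)))"
  proof -
    have "(\<Sum>j\<in>?J. 2 ^ card (?S j) * (card (?S j) + 1)) \<le> (\<Sum>j\<in>?J. 2 ^ (k + 1) * (k + 2))"
    proof (rule sum_mono)
      fix j assume "j \<in> ?J"
      then have "snd j < M" by auto
      then have "card (?S j) \<le> k + 1"
        using S[of "snd j"] card_insert_le_m1[of "k + 1" "S (snd j)" "out (fst j)"] by simp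
      then show "2 ^ card (?S j) * (card (?S j) + 1) \<le> 2 ^ (k + 1) * (k + 2)"
        by (intro mult_le_mono power_increasing) auto
    qed
    also have "\<dots> = card ?J * (2 ^ (k + 1) * (k + 2))" by simp
    also have "card ?J \<le> \<mu> * M"
    proof -
      have "?J \<subseteq> {..<\<mu>} \<times> {..<M}" by auto
      then have "card ?J \<le> card ({..<\<mu>} \<times> {..<M})" by (intro card_mono) auto
      then show ?thesis by (simp only: card_cartesian_product card_lessThan)
    qed
    finally show ?thesis by (simp add: mult.assoc mult_le_mono1)
  qed
  ultimately have D: "implementable N 9 (10 * (\<mu> * (M * (2 ^ (k + 1) * (k + 2))))) (diag ?\<phi>)"
    by (auto intro: implementable_mono)
  have H: "implementable N 1 \<mu> (Had ?O)"
    by (rule implementable_mono[OF implementable_Had[OF o(2)]]) (use cardO in auto)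
  have "implementable N (1 + 9 + 1) (\<mu> + 10 * (\<mu> * (M * (2 ^ (k + 1) * (k + 2)))) + \<mu>)
      (\<lambda>\<psi>. Had ?O (diag ?\<phi> (Had ?O \<psi>)))"
    by (rule implementable_comp[OF implementable_comp[OF H D] H])
  then have "implementable N 11 (2 * \<mu> + 10 * (\<mu> * (M * (2 ^ (k + 1) * (k + 2)))))
      (\<lambda>\<psi>. Had ?O (diag ?\<phi> (Had ?O \<psi>)))"
    by (rule implementable_mono) auto
  then show ?thesis
  proof (rule implementable_cong)
    fix \<psi> assume \<psi>: "\<psi> \<in> qspace N"
    have "?\<phi> y = (\<Prod>i\<in>?O. bit_phase ?c i y)" for y
    proof -
      have "?\<phi> y = (\<Prod>b<\<mu>. \<Prod>t\<in>?T b. cis (pi * of_bool (y ! out b \<and> (\<forall>q\<in>S t. y ! q))))"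
        unfolding cis_sum by (subst prod.Sigma) (auto simp: case_prod_beta intro!: prod.cong)
      also have "\<dots> = (\<Prod>b<\<mu>. bit_phase ?c (out b) y)"
      proof (rule prod.cong[OF refl])
        fix b assume "b \<in> {..<\<mu>}"
        then have b: "inv_into {..<\<mu>} out (out b) = b" using o(1) by simp
        have "(\<Prod>t\<in>?T b. cis (pi * of_bool (y ! out b \<and> (\<forall>q\<in>S t. y ! q)))) =
            (\<Prod>t\<in>?T b. if y ! out b \<and> (\<forall>q\<in>S t. y ! q) then -1 else 1)"
          by (rule prod.cong) auto
        also have "\<dots> = bit_phase ?c (out b) y"
          by (subst prod_sign) (auto simp: bit_phase_def b)
        finally show "(\<Prod>t\<in>?T b. cis (pi * of_bool (y ! out b \<and> (\<forall>q\<in>S t. y ! q)))) =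
            bit_phase ?c (out b) y" .
      qed
      also have "\<dots> = (\<Prod>i\<in>?O. bit_phase ?c i y)" by (simp add: prod.reindex[OF o(1)])
      finally show ?thesis .
    qed
    then have "Had ?O (diag ?\<phi> (Had ?O \<psi>)) = conj_phase ?c ?O \<psi>"
      by (simp add: conj_phase_def)
    also have "\<dots> = (\<lambda>y. \<psi> (flips ?O ?g y))"
    proof (rule conj_phase_flips[OF finO o(2) \<psi>])
      fix p p' :: nat and y :: "bool list" and b assume p: "p \<in> ?O" "p' \<in> ?O"
      have "y[p' := b] ! q = y ! q" if "t < M" "q \<in> S t" for t q
      proof -
        have "p' \<noteq> q" using S[OF that(1)] that(2) p(2) by blast
        then show ?thesis by simp
      qed
      then have "{t\<in>?T (inv_into {..<\<mu>} out p). \<forall>q\<in>S t. y[p' := b] ! q} =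
          {t\<in>?T (inv_into {..<\<mu>} out p). \<forall>q\<in>S t. y ! q}" by auto
      then show "?g p (y[p' := b]) = ?g p y" by simp
    qed
    finally show "Had ?O (diag ?\<phi> (Had ?O \<psi>)) = (\<lambda>y. \<psi> (flips ?O ?g y))" .
  qed
qed

text \<open>Four Hadamard layers on the test qubits, and \<open>implementable_xor_and\<close> for
  2^\<mu> candidates with \<mu> tests each.\<close>

definition digits_cost :: "nat \<Rightarrow> nat" where
  "digits_cost \<mu> = 4 * (2 ^ \<mu> * \<mu>) + 2 * \<mu> + 10 * (\<mu> * (2 ^ \<mu> * (2 ^ (\<mu> + 1) * (\<mu> + 2))))"

text \<open>For a given basis state the digits to be written are fixed, although the tests are in
  superposition. On the support the output step is therefore a constant bit flip; it commutes with
  the test phase because \<open>X\<close> avoids the outputs, and the second test phase cancels the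
  first. Kets on which \<open>lin X \<gamma>\<close> is not a natural number are left unspecified.
  The depth is 2d + 4 + 11.\<close>

lemma implementable_digits:
  assumes D: "implementable (N + 2 ^ \<mu> * \<mu>) d s (diag (test_phase N \<mu> X \<gamma>))"
    and D': "implementable (N + 2 ^ \<mu> * \<mu>) d s (diag (\<lambda>y. cnj (test_phase N \<mu> X \<gamma> y)))"
    and o: "inj_on out {..<\<mu>}" "out ` {..<\<mu>} \<subseteq> {..<N}"
    and X: "X \<subseteq> {..<N}" "X \<inter> out ` {..<\<mu>} = {}"
  obtains A where "implementable (N + 2 ^ \<mu> * \<mu>) (2 * d + 15) (2 * s + digits_cost \<mu>) A"
    "\<And>x k. length x = N \<Longrightarrow> lin X \<gamma> x = real k \<Longrightarrow> A (ket (x @ zeros (2 ^ \<mu> * \<mu>))) =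
       ket (flips (out ` {..<\<mu>}) (\<lambda>i _. bit k (inv_into {..<\<mu>} out i)) x @ zeros (2 ^ \<mu> * \<mu>))"
proof -
  define L where "L = 2 ^ \<mu> * \<mu>"
  let ?N = "N + L" and ?O = "out ` {..<\<mu>}"
  define R where "R = {N..<N + L}"
  define \<phi> where "\<phi> = test_phase N \<mu> X \<gamma>"
  define S where "S t = {N + t * \<mu>..<N + t * \<mu> + \<mu>}" for t
  have finR: "finite R" and RN: "R \<subseteq> {..<?N}" and RO: "R \<inter> ?O = {}"
    and cardR: "card R = L" using o(2) by (auto simp: R_def)
  have SR: "S t \<subseteq> R" if "t < 2 ^ \<mu>" for t
  proof -
    have "Suc t * \<mu> \<le> 2 ^ \<mu> * \<mu>" using that by (intro mult_le_mono1) simp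
    then show ?thesis by (auto simp: S_def R_def L_def)
  qed
  define g where
    "g = (\<lambda>i y. odd (card {t\<in>{t\<in>{..<2 ^ \<mu>}. bit t (inv_into {..<\<mu>} out i)}. \<forall>q\<in>S t. y ! q}))"
  let ?G = "\<lambda>\<psi> y. \<psi> (flips ?O g y)"
  have S: "S t \<subseteq> {..<?N} \<and> S t \<inter> ?O = {} \<and> card (S t) \<le> \<mu>" if "t < 2 ^ \<mu>" for t
    using SR[OF that] RN RO by (auto simp: S_def)
  have G: "implementable ?N 11 (2 * \<mu> + 10 * (\<mu> * (2 ^ \<mu> * (2 ^ (\<mu> + 1) * (\<mu> + 2))))) ?G"
    unfolding g_def by (rule implementable_xor_and[OF o(1)]) (use o(2) S in auto)
  have H: "implementable ?N 1 L (Had R)" using implementable_Had[OF RN] cardR by simp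
  define A where "A \<psi> = Had R (diag (\<lambda>y. cnj (\<phi> y)) (Had R (?G (Had R (diag \<phi> (Had R \<psi>))))))" for \<psi>
  have "implementable ?N (1 + d + 1 + 11 + 1 + d + 1)
     (L + s + L + (2 * \<mu> + 10 * (\<mu> * (2 ^ \<mu> * (2 ^ (\<mu> + 1) * (\<mu> + 2))))) + L + s + L) A"
    unfolding A_def
    using implementable_comp[OF implementable_comp[OF implementable_comp[OF implementable_comp[OF implementable_comp[OF implementable_comp[OF H D[folded L_def \<phi>_def]] H] G] H] D'[folded L_def \<phi>_def]] H]
    by simp
  then have "implementable ?N (2 * d + 15) (2 * s + digits_cost \<mu>) A"
    by (rule implementable_mono) (simp_all add: digits_cost_def L_def)
  moreover have "A (ket (x @ zeros L)) =
       ket (flips ?O (\<lambda>i _. bit k (inv_into {..<\<mu>} out i)) x @ zeros L)"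
    if x: "length x = N" and k: "lin X \<gamma> x = real k" for x k
  proof -
    let ?z = "x @ zeros L"
    let ?v = "\<lambda>i. bit k (inv_into {..<\<mu>} out i)"
    let ?f = "flips ?O (\<lambda>i _. ?v i)"
    define c where "c q = cis (test_angle N \<mu> (real k) q)" for q
    have kz: "ket ?z \<in> qspace ?N" by (rule ket_qspace) (simp add: x)
    have lin_cong: "lin X \<gamma> y = lin X \<gamma> y'" if "\<And>i. i \<in> X \<Longrightarrow> y ! i = y' ! i" for y y'
      unfolding lin_def by (rule sum.cong) (use that in auto)
    \<comment> \<open>Hadamard gates on \<open>R\<close> leave the first \<open>N\<close> bits equal
      to \<open>x\<close>, so on this support the test phases are the constants
      \<open>c q\<close>.\<close>
    define P where "P y = (\<forall>i<N. y ! i = x ! i)" for y :: "bool list"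
    have P: "P (y[q := b]) = P y" if "q \<in> R" for y q b
    proof -
      have "y[q := b] ! i = y ! i" if "i < N" for i
        using \<open>q \<in> R\<close> that by (intro nth_list_update_neq) (auto simp: R_def)
      then show ?thesis by (auto simp: P_def)
    qed
    have "P y" if "Had R (ket ?z) y \<noteq> 0" for y
      by (rule Had_support[OF finR P _ that])
        (use x in \<open>auto simp: ket_def P_def nth_append split: if_splits\<close>)
    moreover have "\<phi> y = (\<Prod>q\<in>R. bit_phase (\<lambda>q _. c q) q y)" if "P y" for y
    proof -
      have "lin X \<gamma> y = real k"
        unfolding k[symmetric] by (rule lin_cong) (use that X in \<open>auto simp: P_def\<close>)
      then show ?thesis
        unfolding \<phi>_def test_phase_def cis_sum
        by (intro prod.cong) (auto simp: R_def L_def c_def bit_phase_def)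
    qed
    ultimately have \<psi>1: "Had R (diag \<phi> (Had R (ket ?z))) = conj_phase (\<lambda>q _. c q) R (ket ?z)"
      unfolding conj_phase_def by (intro arg_cong[of _ _ "Had R"] diag_cong_supp) blast
    define \<psi>1 where "\<psi>1 = Had R (diag \<phi> (Had R (ket ?z)))"
    have \<psi>1_q: "\<psi>1 \<in> qspace ?N" unfolding \<psi>1_def by (intro Had_qspace diag_qspace kz)
    have gv: "g i y = ?v i" if nz: "\<psi>1 y \<noteq> 0" and i: "i \<in> ?O" for i y
    proof -
      let ?b = "inv_into {..<\<mu>} out i"
      have b: "?b < \<mu>" using inv_into_into[OF i] by simp
      have "?z \<in> bitstrings ?N" by (simp add: bitstrings_def x)
      from conj_phase_support[OF finR RN this nz[unfolded \<psi>1_def \<psi>1]]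
      have supp: "c q = 1 \<Longrightarrow> \<not> y ! q" "c q = -1 \<Longrightarrow> y ! q" if "q \<in> R" for q
        using that x by (auto simp: R_def nth_append)
      have E: "(\<forall>q\<in>S t. y ! q) \<longleftrightarrow> t = k mod 2 ^ \<mu>" if t: "t < 2 ^ \<mu>" for t
      proof -
        have c: "c (N + t * \<mu> + j) = cis (2 * pi * ((real k - real t) / 2 ^ (j + 1) + 1 / 2))"
          if "j < \<mu>" for j
        proof -
          have "(N + t * \<mu> + j - N) div \<mu> = t" "(N + t * \<mu> + j - N) mod \<mu> = j"
            using that by simp_all
          then show ?thesis unfolding c_def test_angle_def by (simp only:)
        qed
        show ?thesis
        proof (cases "t = k mod 2 ^ \<mu>")
          case True
          have "y ! q" if "q \<in> S t" for q
          proof -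
            define j where "j = q - (N + t * \<mu>)"
            have j: "j < \<mu>" "q = N + t * \<mu> + j" using that by (auto simp: S_def j_def)
            have "c q = -1"
              unfolding j(2) c[OF j(1)] by (rule cis_test_angle(1)[OF t True j(1)])
            then show ?thesis using supp SR[OF t] that by blast
          qed
          then show ?thesis using True by blast
        next
          case False
          from cis_test_angle(2)[OF t False] obtain j where j: "j < \<mu>"
            "cis (2 * pi * ((real k - real t) / 2 ^ (j + 1) + 1 / 2)) = 1" by blast
          have q: "N + t * \<mu> + j \<in> S t" using j(1) by (simp add: S_def)
          have "c (N + t * \<mu> + j) = 1" unfolding c[OF j(1)] by (rule j(2))
          then have "\<not> y ! (N + t * \<mu> + j)" using supp(1) q SR[OF t] by blast
          then show ?thesis using False q by blast
        qed
      qed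
      have "{t\<in>{t\<in>{..<2 ^ \<mu>}. bit t ?b}. \<forall>q\<in>S t. y ! q} =
          {t\<in>{..<2 ^ \<mu>}. bit t ?b \<and> t = k mod 2 ^ \<mu>}" using E by blast
      also have "\<dots> = (if bit (k mod 2 ^ \<mu>) ?b then {k mod 2 ^ \<mu>} else {})" by auto
      finally have "{t\<in>{t\<in>{..<2 ^ \<mu>}. bit t ?b}. \<forall>q\<in>S t. y ! q} =
          (if bit (k mod 2 ^ \<mu>) ?b then {k mod 2 ^ \<mu>} else {})" .
      moreover have "bit (k mod 2 ^ \<mu>) ?b = bit k ?b"
        using b by (simp add: bit_take_bit_iff flip: take_bit_eq_mod)
      ultimately show ?thesis by (simp add: g_def)
    qed
    have g_inv: "g i (flips ?O h y) = g i y" if "length y = ?N" for i y h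
    proof -
      have "flips ?O h y ! q = y ! q" if "t < 2 ^ \<mu>" "q \<in> S t" for t q
        using S[OF that(1)] that(2) \<open>length y = ?N\<close> by (subst nth_flips) auto
      then have "{t\<in>{t\<in>{..<2 ^ \<mu>}. bit t (inv_into {..<\<mu>} out i)}. \<forall>q\<in>S t. flips ?O h y ! q} =
          {t\<in>{t\<in>{..<2 ^ \<mu>}. bit t (inv_into {..<\<mu>} out i)}. \<forall>q\<in>S t. y ! q}" by auto
      then show ?thesis by (simp add: g_def)
    qed
    have fl_cong: "flips ?O g y = ?f y" if "\<And>i. i \<in> ?O \<Longrightarrow> g i y = ?v i" for y
      unfolding flips_def by (rule map_cong) (use that in auto)
    have "?G \<psi>1 = (\<lambda>y. \<psi>1 (?f y))"
    proof (rule qspace_eqI)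
      fix y :: "bool list" assume y: "length y = ?N"
      show "?G \<psi>1 y = \<psi>1 (?f y)"
      proof (cases "\<psi>1 (flips ?O g y) = 0 \<and> \<psi>1 (?f y) = 0")
        \<comment> \<open>One of the two amplitudes is non-zero. There \<open>gv\<close> applies,
          and \<open>g\<close> does not see the output bits in which that string may differ from
          \<open>y\<close>.\<close>
        case False
        then have "g i y = ?v i" if "i \<in> ?O" for i
          using gv[OF _ that, of "flips ?O g y"] gv[OF _ that, of "?f y"]
            g_inv[OF y, of i g] g_inv[OF y, of i "\<lambda>i _. ?v i"] by argo
        then show ?thesis using fl_cong by simp
      qed simp
    qed (rule pull_qspace[OF \<psi>1_q], simp)+
    then have "A (ket ?z) = Had R (diag (\<lambda>y. cnj (\<phi> y)) (Had R (\<lambda>y. \<psi>1 (?f y))))"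
      by (simp add: A_def \<psi>1_def)
    also have "Had R (\<lambda>y. \<psi>1 (?f y)) = (\<lambda>y. diag \<phi> (Had R (ket ?z)) (?f y))"
      unfolding Had_flips_const[OF finR RN RO \<psi>1_q] unfolding \<psi>1_def
      using Had_Had[OF finR RN diag_qspace[OF Had_qspace[OF kz]]] by simp
    also have "diag (\<lambda>y. cnj (\<phi> y)) \<dots> = (\<lambda>y. Had R (ket ?z) (?f y))"
    proof (rule qspace_eqI)
      show "(\<lambda>y. Had R (ket ?z) (?f y)) \<in> qspace ?N"
        by (rule pull_qspace[OF Had_qspace[OF kz]]) simp
      show "diag (\<lambda>y. cnj (\<phi> y)) (\<lambda>y. diag \<phi> (Had R (ket ?z)) (?f y)) \<in> qspace ?N"
        by (rule diag_qspace, rule pull_qspace[OF diag_qspace[OF Had_qspace[OF kz]]]) simp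
      fix y :: "bool list" assume y: "length y = ?N"
      have "lin X \<gamma> (?f y) = lin X \<gamma> y"
      proof (rule lin_cong)
        fix i assume "i \<in> X"
        then have "i < length y" "i \<notin> ?O" using X y by auto
        then show "?f y ! i = y ! i" by (simp add: nth_flips)
      qed
      moreover have "?f y ! q = y ! q" if "q \<in> R" for q
        using that RO RN y by (subst nth_flips) auto
      ultimately have "\<phi> (?f y) = \<phi> y"
        unfolding \<phi>_def test_phase_def
        by (intro arg_cong[of _ _ cis] sum.cong) (auto simp: R_def L_def)
      moreover have "cnj (\<phi> y) * \<phi> y = 1"
        by (simp add: \<phi>_def test_phase_def cis_cnj cis_mult)
      ultimately show "diag (\<lambda>y. cnj (\<phi> y)) (\<lambda>y. diag \<phi> (Had R (ket ?z)) (?f y)) y =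
          Had R (ket ?z) (?f y)"
        by (simp add: diag_def flip: mult.assoc)
    qed
    also have "Had R \<dots> = (\<lambda>y. ket ?z (?f y))"
      unfolding Had_flips_const[OF finR RN RO Had_qspace[OF kz]]
      using Had_Had[OF finR RN kz] by simp
    also have "\<dots> = ket (?f ?z)" by (rule flips_ket) (simp add: x)
    also have "?f ?z = ?f x @ zeros L"
      by (rule nth_equalityI) (use x o(2) in \<open>auto simp: nth_flips nth_append\<close>)
    finally show ?thesis .
  qed
  ultimately show ?thesis using that[of A] unfolding L_def by blast
qed


section \<open>Weighted sums and cheap test phases\<close>

lemma implementable_sum:
  assumes A: "implementable N d s A" and v: "\<And>x. x \<in> X \<Longrightarrow> v x \<in> qspace N"
  shows "A (\<lambda>y. \<Sum>x\<in>X. k x * v x y) = (\<lambda>y. \<Sum>x\<in>X. k x * A (v x) y)"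
proof
  fix y
  have q: "(\<lambda>y. \<Sum>x\<in>X. k x * v x y) \<in> qspace N"
    by (rule qspaceI) (auto intro!: sum.neutral dest: v[THEN qspaceD])
  have "A (\<lambda>y. \<Sum>x\<in>X. k x * v x y) y =
      (\<Sum>z\<in>bitstrings N. (\<Sum>x\<in>X. k x * v x z) * A (ket z) y)"
    by (subst implementable_linear[OF A q]) simp
  also have "\<dots> = (\<Sum>x\<in>X. k x * (\<Sum>z\<in>bitstrings N. v x z * A (ket z) y))"
    unfolding sum_distrib_left sum_distrib_right by (subst sum.swap) (simp add: mult.assoc)
  also have "\<dots> = (\<Sum>x\<in>X. k x * A (v x) y)"
  proof (rule sum.cong[OF refl])
    fix x assume "x \<in> X"
    then show "k x * (\<Sum>z\<in>bitstrings N. v x z * A (ket z) y) = k x * A (v x) y"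
      by (subst implementable_linear[OF A v]) auto
  qed
  finally show "A (\<lambda>y. \<Sum>x\<in>X. k x * v x y) y = (\<Sum>x\<in>X. k x * A (v x) y)" .
qed

lemma implementable_with_zeros_linear:
  assumes A: "implementable (N + l) d s A" and \<psi>: "\<psi> \<in> qspace N"
  shows "A (with_zeros N l \<psi>) = (\<lambda>y. \<Sum>x\<in>bitstrings N. \<psi> x * A (ket (x @ zeros l)) y)"
proof -
  have "with_zeros N l \<psi> = (\<lambda>z. \<Sum>x\<in>bitstrings N. \<psi> x * with_zeros N l (ket x) z)"
    by (subst qspace_expand[OF \<psi>]) (simp add: with_zeros_def sum_distrib_right mult.assoc)
  also have "\<dots> = (\<lambda>z. \<Sum>x\<in>bitstrings N. \<psi> x * ket (x @ zeros l) z)"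
    by (intro ext sum.cong) (auto simp: bitstrings_def with_zeros_ket)
  finally show ?thesis
    using implementable_sum[OF A, of "bitstrings N" "\<lambda>x. ket (x @ zeros l)" \<psi>]
    by (simp add: bitstrings_def ket_qspace)
qed

lemma sum_ket_involution:
  assumes len: "\<And>x. length (f x) = length x" and ff: "\<And>x. length x = N \<Longrightarrow> f (f x) = x"
    and y: "length y = N + l"
  shows "(\<Sum>x\<in>bitstrings N. \<psi> x * ket (f x @ zeros l) y) = with_zeros N l (\<lambda>y. \<psi> (f y)) y"
proof -
  have "(\<Sum>x\<in>bitstrings N. \<psi> x * ket (f x @ zeros l) y) =
      (\<Sum>x\<in>bitstrings N. if x = f (take N y) then if drop N y = zeros l then \<psi> x else 0 else 0)"
  proof (rule sum.cong[OF refl])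
    fix x assume "x \<in> bitstrings N"
    then have x: "length x = N" by (simp add: bitstrings_def)
    have "y = f x @ zeros l \<longleftrightarrow> f x = take N y \<and> drop N y = zeros l"
      using append_eq_conv_conj[of "f x" "zeros l" y] len[of x] x by auto
    moreover have "f x = take N y \<longleftrightarrow> x = f (take N y)"
    proof
      assume "f x = take N y" then show "x = f (take N y)" using ff[OF x] by simp
    next
      assume "x = f (take N y)" then show "f x = take N y" using ff[of "take N y"] y by simp
    qed
    ultimately show "\<psi> x * ket (f x @ zeros l) y =
        (if x = f (take N y) then if drop N y = zeros l then \<psi> x else 0 else 0)"
      by (simp add: ket_def)
  qed
  also have "\<dots> = with_zeros N l (\<lambda>y. \<psi> (f y)) y"
    using y by (subst sum.delta[OF finite_bitstrings]) (auto simp: with_zeros_apply len bitstrings_def)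
  finally show ?thesis .
qed

text \<open>By linearity the kets determine \<open>B\<close> on all states with zero work qubits,
  and for an involution mapping kets by \<open>f\<close> is the same as pulling back along
  \<open>f\<close>.\<close>

lemma implementable_hide_kets:
  assumes B: "implementable (N + l) d s B"
    and f: "\<And>x. length x = N \<Longrightarrow> B (ket (x @ zeros l)) = ket (f x @ zeros l)"
    and len: "\<And>x. length (f x) = length x" and ff: "\<And>x. length x = N \<Longrightarrow> f (f x) = x"
  shows "implementable N d s (\<lambda>\<psi> y. \<psi> (f y))"
proof (rule implementable_hide[OF B])
  fix \<psi> assume \<psi>: "\<psi> \<in> qspace N"
  show 1: "(\<lambda>y. \<psi> (f y)) \<in> qspace N" by (rule pull_qspace[OF \<psi> len])
  show "B (with_zeros N l \<psi>) = with_zeros N l (\<lambda>y. \<psi> (f y))"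
  proof (rule qspace_eqI)
    fix y :: "bool list" assume y: "length y = N + l"
    have "B (with_zeros N l \<psi>) y = (\<Sum>x\<in>bitstrings N. \<psi> x * ket (f x @ zeros l) y)"
      unfolding implementable_with_zeros_linear[OF B \<psi>]
      by (rule sum.cong) (simp_all add: f bitstrings_def)
    then show "B (with_zeros N l \<psi>) y = with_zeros N l (\<lambda>y. \<psi> (f y)) y"
      using sum_ket_involution[OF len ff y] by simp
  qed (use with_zeros_qspace[OF 1] implementable_qspace[OF B with_zeros_qspace[OF \<psi>]] in auto)
qed

section \<open>Phases linear or bilinear in the bits\<close>

lemma implementable_pair_phase:
  assumes "finite I" "finite J" "I \<inter> J = {}" "I \<subseteq> {..<N}" "J \<subseteq> {..<N}"
  shows "implementable N 9 (120 * (card I * card J))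
    (diag (\<lambda>y. cis (\<Sum>(i, j)\<in>I \<times> J. \<theta> i j * of_bool (y ! i \<and> y ! j))))"
proof -
  have "implementable N 9 (10 * (\<Sum>p\<in>I \<times> J. 2 ^ card {fst p, snd p} * (card {fst p, snd p} + 1)))
    (diag (\<lambda>y. cis (\<Sum>p\<in>I \<times> J. \<theta> (fst p) (snd p) * of_bool (\<forall>q\<in>{fst p, snd p}. y ! q))))"
    by (rule implementable_and_phase) (use assms in auto)
  \<comment> \<open>12 = 2^2 * (2 + 1) bounds the cost of the four subsets of a pair; times 10 this
    gives 120.\<close>
  moreover have "(\<Sum>p\<in>I \<times> J. 2 ^ card {fst p, snd p} * (card {fst p, snd p} + 1)) =
      (\<Sum>p\<in>I \<times> J. 12)"
  proof (rule sum.cong[OF refl])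
    fix p assume "p \<in> I \<times> J"
    then have "fst p \<noteq> snd p" using assms(3) by auto
    then have "card {fst p, snd p} = 2" by simp
    then show "2 ^ card {fst p, snd p} * (card {fst p, snd p} + 1) = 12" by simp
  qed
  ultimately show ?thesis by (simp add: case_prod_beta card_cartesian_product mult.commute)
qed

lemma implementable_single_phase:
  assumes "finite I" "I \<subseteq> {..<N}"
  shows "implementable N 9 (40 * card I) (diag (\<lambda>y. cis (\<Sum>i\<in>I. \<theta> i * of_bool (y ! i))))"
  using implementable_and_phase[OF assms(1), of "\<lambda>i. {i}" N \<theta>] assms(2) by (auto simp: mult.commute)

lemma test_angle_split:
  "test_angle N \<mu> f q = 2 * pi * f / 2 ^ ((q - N) mod \<mu> + 1) + test_angle N \<mu> 0 q"
  by (simp add: test_angle_def field_simps)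

text \<open>The angles are affine in \<open>f\<close>, and the coefficient of \<open>f\<close> is
  one weighted sum of the test qubits, the same for all input bits. The sign \<open>\<sigma>\<close>
  treats a test phase and its conjugate together.\<close>

lemma test_phase_split:
  fixes N \<mu> :: nat and \<sigma> :: real
  defines "R \<equiv> {N..<N + 2 ^ \<mu> * \<mu>}"
  shows "\<sigma> * (\<Sum>q\<in>R. of_bool (y ! q) * test_angle N \<mu> f q) =
    \<sigma> * (2 * pi * f * (\<Sum>q\<in>R. of_bool (y ! q) / 2 ^ ((q - N) mod \<mu> + 1))) +
    (\<Sum>q\<in>R. \<sigma> * test_angle N \<mu> 0 q * of_bool (y ! q))"
proof -
  have "(\<Sum>q\<in>R. of_bool (y ! q) * test_angle N \<mu> f q) =
      (\<Sum>q\<in>R. 2 * pi * f * (of_bool (y ! q) / 2 ^ ((q - N) mod \<mu> + 1)) +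
        test_angle N \<mu> 0 q * of_bool (y ! q))"
    by (rule sum.cong[OF refl]) (subst test_angle_split, simp add: field_simps)
  then show ?thesis
    by (simp add: sum.distrib sum_distrib_left distrib_left mult.assoc)
qed

text \<open>One phase per pair of a test qubit and an element of \<open>X\<close>. This is too
  expensive for \<open>n\<close> input bits and serves only to add up test qubits.\<close>

lemma implementable_test_phase_direct:
  fixes N \<mu> :: nat and \<sigma> :: real
  assumes X: "X \<subseteq> {..<N}"
  defines "R \<equiv> {N..<N + 2 ^ \<mu> * \<mu>}"
  shows "implementable (N + 2 ^ \<mu> * \<mu>) 18 (120 * (2 ^ \<mu> * \<mu> * card X) + 40 * (2 ^ \<mu> * \<mu>))
    (diag (\<lambda>y. cis (\<sigma> * (\<Sum>q\<in>R. of_bool (y ! q) * test_angle N \<mu> (lin X \<gamma> y) q))))"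
proof -
  let ?N = "N + 2 ^ \<mu> * \<mu>"
  have fin: "finite X" using X finite_subset by blast
  let ?\<theta> = "\<lambda>q i. \<sigma> * (2 * pi * \<gamma> i / 2 ^ ((q - N) mod \<mu> + 1))"
  have 1: "implementable ?N 9 (120 * (card R * card X))
      (diag (\<lambda>y. cis (\<Sum>(q, i)\<in>R \<times> X. ?\<theta> q i * of_bool (y ! q \<and> y ! i))))"
    by (rule implementable_pair_phase) (use X fin in \<open>auto simp: R_def\<close>)
  have 2: "implementable ?N 9 (40 * card R)
      (diag (\<lambda>y. cis (\<Sum>q\<in>R. \<sigma> * test_angle N \<mu> 0 q * of_bool (y ! q))))"
    by (rule implementable_single_phase) (auto simp: R_def)
  have eq: "cis (\<sigma> * (\<Sum>q\<in>R. of_bool (y ! q) * test_angle N \<mu> (lin X \<gamma> y) q)) =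
      cis (\<Sum>q\<in>R. \<sigma> * test_angle N \<mu> 0 q * of_bool (y ! q)) *
      cis (\<Sum>(q, i)\<in>R \<times> X. ?\<theta> q i * of_bool (y ! q \<and> y ! i))" for y
  proof -
    have "(\<Sum>(q, i)\<in>R \<times> X. ?\<theta> q i * of_bool (y ! q \<and> y ! i)) =
        (\<Sum>q\<in>R. \<Sum>i\<in>X. ?\<theta> q i * of_bool (y ! q \<and> y ! i))"
      by (simp add: sum.cartesian_product)
    also have "\<dots> = (\<Sum>q\<in>R. \<Sum>i\<in>X. \<sigma> * (2 * pi * (\<gamma> i * of_bool (y ! i)) *
        (of_bool (y ! q) / 2 ^ ((q - N) mod \<mu> + 1))))"
      by (intro sum.cong refl) auto
    also have "\<dots> = \<sigma> * (2 * pi * lin X \<gamma> y * (\<Sum>q\<in>R. of_bool (y ! q) / 2 ^ ((q - N) mod \<mu> + 1)))"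
      unfolding lin_def sum_distrib_left sum_distrib_right by (rule refl)
    finally show ?thesis
      unfolding R_def test_phase_split cis_mult by (simp add: add.commute)
  qed
  show ?thesis
    using implementable_comp[OF 1 2] unfolding diag_diag eq[symmetric]
    by (simp add: R_def)
qed

definition sum_cost :: "nat \<Rightarrow> nat \<Rightarrow> nat" where
  "sum_cost \<nu> c = 2 * (120 * (2 ^ \<nu> * \<nu> * c) + 40 * (2 ^ \<nu> * \<nu>)) + digits_cost \<nu>"

text \<open>Natural weights make the sum a natural number on every basis state, so the digit
  extraction covers all kets and its test qubits can be hidden. The depth is 2 * 18 + 15.\<close>

lemma implementable_weighted_sum:
  fixes w :: "nat \<Rightarrow> nat"
  assumes o: "inj_on out {..<\<nu>}" "out ` {..<\<nu>} \<subseteq> {..<N}"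
    and X: "X \<subseteq> {..<N}" "X \<inter> out ` {..<\<nu>} = {}"
  shows "implementable N 51 (sum_cost \<nu> (card X)) (\<lambda>\<psi> y. \<psi> (flips (out ` {..<\<nu>})
    (\<lambda>i y. bit (\<Sum>j\<in>X. w j * of_bool (y ! j)) (inv_into {..<\<nu>} out i)) y))"
proof -
  let ?g = "\<lambda>i y. bit (\<Sum>j\<in>X. w j * of_bool (y ! j)) (inv_into {..<\<nu>} out i)"
  let ?L = "2 ^ \<nu> * \<nu>"
  define \<gamma> where "\<gamma> j = real (w j)" for j
  have D: "implementable (N + ?L) 18 (120 * (?L * card X) + 40 * ?L) (diag (test_phase N \<nu> X \<gamma>))"
    using implementable_test_phase_direct[OF X(1), of \<nu> 1 \<gamma>] by (simp add: test_phase_def[abs_def])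
  have D': "implementable (N + ?L) 18 (120 * (?L * card X) + 40 * ?L) (diag (\<lambda>y. cnj (test_phase N \<nu> X \<gamma> y)))"
    using implementable_test_phase_direct[OF X(1), of \<nu> "-1" \<gamma>] by (simp add: test_phase_def cis_cnj)
  obtain A where A: "implementable (N + ?L) (2 * 18 + 15)
      (2 * (120 * (?L * card X) + 40 * ?L) + digits_cost \<nu>) A"
    "\<And>x k. length x = N \<Longrightarrow> lin X \<gamma> x = real k \<Longrightarrow> A (ket (x @ zeros ?L)) =
       ket (flips (out ` {..<\<nu>}) (\<lambda>i _. bit k (inv_into {..<\<nu>} out i)) x @ zeros ?L)"
    using implementable_digits[OF D D' o X] by blast
  have lin: "lin X \<gamma> x = real (\<Sum>j\<in>X. w j * of_bool (x ! j))" for x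
    unfolding lin_def \<gamma>_def of_nat_sum by (rule sum.cong) auto
  have "implementable N (2 * 18 + 15) (2 * (120 * (?L * card X) + 40 * ?L) + digits_cost \<nu>)
      (\<lambda>\<psi> y. \<psi> (flips (out ` {..<\<nu>}) ?g y))"
  proof (rule implementable_hide_kets[OF A(1)])
    fix x :: "bool list" assume x: "length x = N"
    have "flips (out ` {..<\<nu>}) (\<lambda>i _. ?g i x) x = flips (out ` {..<\<nu>}) ?g x"
      by (simp add: flips_def)
    then show "A (ket (x @ zeros ?L)) = ket (flips (out ` {..<\<nu>}) ?g x @ zeros ?L)"
      using A(2)[OF x lin] by simp
    show "flips (out ` {..<\<nu>}) ?g (flips (out ` {..<\<nu>}) ?g x) = x"
    proof (rule flips_flips)
      fix i
      have "flips (out ` {..<\<nu>}) ?g x ! j = x ! j" if "j \<in> X" for j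
        using that X x by (subst nth_flips) auto
      then have "(\<Sum>j\<in>X. w j * of_bool (flips (out ` {..<\<nu>}) ?g x ! j)) =
          (\<Sum>j\<in>X. w j * of_bool (x ! j))" by (intro sum.cong) auto
      then show "?g i (flips (out ` {..<\<nu>}) ?g x) = ?g i x" by simp
    qed
  qed simp
  then show ?thesis by (simp add: sum_cost_def)
qed

lemma sum_bits: "(\<Sum>b<\<nu>. 2 ^ b * of_bool (bit (k::nat) b)) = k mod 2 ^ \<nu>"
proof -
  have "take_bit \<nu> k = (\<Sum>b = 0..<\<nu>. push_bit b (of_bool (bit k b)))" by (rule take_bit_sum)
  also have "\<dots> = (\<Sum>b<\<nu>. 2 ^ b * of_bool (bit k b))"
    by (simp add: push_bit_eq_mult atLeast0LessThan mult.commute)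
  finally show ?thesis by (simp add: take_bit_eq_mod)
qed

text \<open>
  The weighted sum of the test qubits is an integer below \<open>2^(3\<mu>)\<close>, so it is computed without
  reduction; the phase identity then also holds where \<open>lin X \<gamma> y\<close> is not an integer.
\<close>

definition test_cost :: "nat \<Rightarrow> nat \<Rightarrow> nat" where
  "test_cost \<mu> c = 2 * sum_cost (3 * \<mu>) (2 ^ \<mu> * \<mu>) + 120 * (c * (3 * \<mu>)) + 40 * (2 ^ \<mu> * \<mu>)"

text \<open>The sum \<open>W\<close> of the test qubits is written to \<open>3 * \<mu>\<close> fresh
  qubits, the input bits are paired with these only, and \<open>W\<close> is erased by the same
  involution. Thus \<open>card X\<close> is multiplied by \<open>3 * \<mu>\<close> instead of
  \<open>2 ^ \<mu> * \<mu>\<close>. The depth is 51 + 9 + 9 + 51.\<close>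

lemma implementable_test_phase:
  fixes N \<mu> :: nat and \<sigma> :: real
  assumes X: "X \<subseteq> {..<N}"
  defines "R \<equiv> {N..<N + 2 ^ \<mu> * \<mu>}"
  shows "implementable (N + 2 ^ \<mu> * \<mu>) 120 (test_cost \<mu> (card X))
    (diag (\<lambda>y. cis (\<sigma> * (\<Sum>q\<in>R. of_bool (y ! q) * test_angle N \<mu> (lin X \<gamma> y) q))))"
proof -
  define L where "L = 2 ^ \<mu> * \<mu>"
  define \<nu> where "\<nu> = 3 * \<mu>"
  let ?N = "N + L"
  let ?out = "\<lambda>b. ?N + b"
  let ?O = "?out ` {..<\<nu>}"
  \<comment> \<open>The factor 2^\<mu> makes the weight 1 / 2^(j+1) of a test at level j
    natural.\<close>
  define w :: "nat \<Rightarrow> nat" where "w q = 2 ^ (\<mu> - 1 - (q - N) mod \<mu>)" for q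
  define W where "W y = (\<Sum>q\<in>R. w q * of_bool (y ! q))" for y :: "bool list"
  let ?f = "flips ?O (\<lambda>i y. bit (W y) (inv_into {..<\<nu>} ?out i))"
  have R: "R = {N..<?N}" by (simp add: R_def L_def)
  have fin: "finite X" using X finite_subset by blast
  have inj: "inj_on ?out {..<\<nu>}" by simp
  have "implementable (?N + \<nu>) 51 (sum_cost \<nu> (card R)) (\<lambda>\<psi> y. \<psi> (?f y))"
    unfolding W_def by (rule implementable_weighted_sum[OF inj]) (auto simp: R)
  moreover have cR: "card R = L" by (simp add: R)
  ultimately have E: "implementable (?N + \<nu>) 51 (sum_cost \<nu> L) (\<lambda>\<psi> y. \<psi> (?f y))" by simp
  let ?\<theta> = "\<lambda>i b. \<sigma> * (2 * pi * \<gamma> i * 2 ^ (b - ?N) / 2 ^ \<mu>)"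
  let ?\<phi>1 = "\<lambda>y. cis (\<Sum>(i, b)\<in>X \<times> ?O. ?\<theta> i b * of_bool (y ! i \<and> y ! b))"
  let ?\<phi>2 = "\<lambda>y. cis (\<Sum>q\<in>R. \<sigma> * test_angle N \<mu> 0 q * of_bool (y ! q))"
  let ?\<phi> = "\<lambda>y. cis (\<sigma> * (\<Sum>q\<in>R. of_bool (y ! q) * test_angle N \<mu> (lin X \<gamma> y) q))"
  have 1: "implementable (?N + \<nu>) 9 (120 * (card X * \<nu>)) (diag ?\<phi>1)"
  proof -
    have "implementable (?N + \<nu>) 9 (120 * (card X * card ?O)) (diag ?\<phi>1)"
      by (rule implementable_pair_phase) (use X fin in auto)
    moreover have "card ?O = \<nu>" by (simp add: card_image)
    ultimately show ?thesis by (simp only:)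
  qed
  have 2: "implementable (?N + \<nu>) 9 (40 * L) (diag ?\<phi>2)"
  proof -
    have "finite R" "R \<subseteq> {..<?N + \<nu>}" by (auto simp: R)
    then have "implementable (?N + \<nu>) 9 (40 * card R) (diag ?\<phi>2)" by (rule implementable_single_phase)
    then show ?thesis by (simp only: cR)
  qed
  let ?B = "\<lambda>\<psi> y. diag ?\<phi>2 (diag ?\<phi>1 (\<lambda>y. \<psi> (?f y))) (?f y)"
  have "implementable (?N + \<nu>) (51 + 9 + 9 + 51)
      (sum_cost \<nu> L + 120 * (card X * \<nu>) + 40 * L + sum_cost \<nu> L) ?B"
    by (rule implementable_comp[OF implementable_comp[OF implementable_comp[OF E 1] 2] E])
  then have B: "implementable (?N + \<nu>) 120 (test_cost \<mu> (card X)) ?B"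
    by (rule implementable_mono) (simp_all add: test_cost_def \<nu>_def L_def)
  \<comment> \<open>There are \<open>2 ^ \<mu> * \<mu>\<close> test qubits of weight at most
    \<open>2 ^ (\<mu> - 1)\<close>, and \<mu> < 2^\<mu>; this is where the width
    \<open>3 * \<mu>\<close> comes from.\<close>
  have W_less: "W y < 2 ^ \<nu>" for y
  proof (cases "\<mu> = 0")
    case True
    then show ?thesis by (simp add: W_def R_def)
  next
    case False
    have "W y \<le> (\<Sum>q\<in>R. 2 ^ (\<mu> - 1))"
      unfolding W_def w_def by (rule sum_mono) (auto intro!: diff_le_mono2)
    also have "\<dots> = 2 ^ \<mu> * \<mu> * 2 ^ (\<mu> - 1)" by (simp add: R_def)
    also have "\<dots> < 2 ^ \<mu> * 2 ^ \<mu> * 2 ^ \<mu>"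
      using False by (intro mult_le_less_imp_less) auto
    also have "\<dots> = 2 ^ \<nu>" by (simp add: \<nu>_def flip: power_add)
    finally show ?thesis .
  qed
  have W_eq: "(\<Sum>q\<in>R. of_bool (y ! q) / 2 ^ ((q - N) mod \<mu> + 1)) = real (W y) / 2 ^ \<mu>" for y
    unfolding W_def of_nat_sum sum_divide_distrib
  proof (rule sum.cong[OF refl])
    fix q assume "q \<in> R"
    then have "\<mu> \<noteq> 0" by (cases "\<mu> = 0") (auto simp: R_def)
    then have "(q - N) mod \<mu> < \<mu>" by simp
    then have "\<mu> = (\<mu> - 1 - (q - N) mod \<mu>) + ((q - N) mod \<mu> + 1)" by simp
    from arg_cong[OF this, of "\<lambda>n. (2::real) ^ n"]
    have "(2::real) ^ \<mu> = real (w q) * 2 ^ ((q - N) mod \<mu> + 1)"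
      by (simp only: power_add w_def of_nat_power of_nat_numeral)
    moreover have "real (w q) \<noteq> 0" by (simp add: w_def)
    ultimately show "of_bool (y ! q) / 2 ^ ((q - N) mod \<mu> + 1) =
        real (w q * of_bool (y ! q)) / 2 ^ \<mu>" by simp
  qed
  have W_cong: "W z = W y" if "\<And>q. q \<in> R \<Longrightarrow> z ! q = y ! q" for z y
    unfolding W_def by (rule sum.cong) (simp_all add: that)
  show ?thesis
    unfolding L_def[symmetric]
  proof (rule implementable_hide[OF B])
    fix \<psi> assume \<psi>: "\<psi> \<in> qspace ?N"
    show "diag ?\<phi> \<psi> \<in> qspace ?N" by (rule diag_qspace[OF \<psi>])
    have q: "with_zeros ?N \<nu> \<psi> \<in> qspace (?N + \<nu>)" by (rule with_zeros_qspace[OF \<psi>])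
    show "?B (with_zeros ?N \<nu> \<psi>) = with_zeros ?N \<nu> (diag ?\<phi> \<psi>)"
    proof (rule qspace_eqI)
      show "?B (with_zeros ?N \<nu> \<psi>) \<in> qspace (?N + \<nu>)" by (rule implementable_qspace[OF B q])
      show "with_zeros ?N \<nu> (diag ?\<phi> \<psi>) \<in> qspace (?N + \<nu>)"
        by (intro with_zeros_qspace diag_qspace \<psi>)
      fix y :: "bool list" assume y: "length y = ?N + \<nu>"
      have f_low: "?f y ! i = y ! i" if "i < ?N" for i
        using that y by (subst nth_flips) auto
      have Wf: "W (?f y) = W y"
        by (rule W_cong) (simp add: R f_low)
      have ff: "?f (?f y) = y"
        by (rule flips_flips) (simp add: Wf)
      have B_y: "?B (with_zeros ?N \<nu> \<psi>) y = ?\<phi>2 (?f y) * ?\<phi>1 (?f y) * with_zeros ?N \<nu> \<psi> y"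
        by (simp only: diag_def ff mult.assoc)
      show "?B (with_zeros ?N \<nu> \<psi>) y = with_zeros ?N \<nu> (diag ?\<phi> \<psi>) y"
      proof (cases "drop ?N y = zeros \<nu>")
        case True
        have y0: "\<not> y ! (?N + b)" if "b < \<nu>" for b
          using that y arg_cong[OF True, of "\<lambda>l. l ! b"] by simp
        have fb: "?f y ! (?N + b) = bit (W y) b" if "b < \<nu>" for b
        proof -
          have "inv_into {..<\<nu>} ?out (?out b) = b" using that by (intro inv_into_f_f inj) auto
          moreover have "?N + b \<in> ?O" using that by auto
          ultimately show ?thesis using y0[OF that] y that by (simp add: nth_flips)
        qed
        have Xi: "i < ?N" if "i \<in> X" for i using that X by auto
        have "(\<Sum>(i, b)\<in>X \<times> ?O. ?\<theta> i b * of_bool (?f y ! i \<and> ?f y ! b)) =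
            (\<Sum>i\<in>X. \<Sum>b\<in>?O. ?\<theta> i b * of_bool (?f y ! i \<and> ?f y ! b))"
          by (simp add: sum.cartesian_product)
        also have "\<dots> = (\<Sum>i\<in>X. \<Sum>b<\<nu>. \<sigma> * (2 * pi * (\<gamma> i * of_bool (y ! i)) *
            (real (2 ^ b * of_bool (bit (W y) b)) / 2 ^ \<mu>)))"
        proof (rule sum.cong[OF refl])
          fix i assume i: "i \<in> X"
          have "(\<Sum>b\<in>?O. ?\<theta> i b * of_bool (?f y ! i \<and> ?f y ! b)) =
              (\<Sum>b<\<nu>. ?\<theta> i (?N + b) * of_bool (?f y ! i \<and> ?f y ! (?N + b)))"
            by (subst sum.reindex[OF inj]) (simp add: comp_def)
          also have "\<dots> = (\<Sum>b<\<nu>. \<sigma> * (2 * pi * (\<gamma> i * of_bool (y ! i)) *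
              (real (2 ^ b * of_bool (bit (W y) b)) / 2 ^ \<mu>)))"
          proof (rule sum.cong[OF refl])
            fix b assume "b \<in> {..<\<nu>}"
            then show "?\<theta> i (?N + b) * of_bool (?f y ! i \<and> ?f y ! (?N + b)) =
                \<sigma> * (2 * pi * (\<gamma> i * of_bool (y ! i)) * (real (2 ^ b * of_bool (bit (W y) b)) / 2 ^ \<mu>))"
              using f_low[OF Xi[OF i]] fb[of b] by (simp del: sum_of_bool_eq)
          qed
          finally show "(\<Sum>b\<in>?O. ?\<theta> i b * of_bool (?f y ! i \<and> ?f y ! b)) =
              (\<Sum>b<\<nu>. \<sigma> * (2 * pi * (\<gamma> i * of_bool (y ! i)) *
              (real (2 ^ b * of_bool (bit (W y) b)) / 2 ^ \<mu>)))" .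
        qed
        also have "\<dots> = \<sigma> * (2 * pi * lin X \<gamma> y * (real (\<Sum>b<\<nu>. 2 ^ b * of_bool (bit (W y) b)) / 2 ^ \<mu>))"
          unfolding lin_def sum_distrib_left sum_distrib_right of_nat_sum sum_divide_distrib
          by (rule sum.swap)
        also have "\<dots> = \<sigma> * (2 * pi * lin X \<gamma> y * (\<Sum>q\<in>R. of_bool (y ! q) / 2 ^ ((q - N) mod \<mu> + 1)))"
          by (simp only: sum_bits mod_less[OF W_less] W_eq)
        finally have e1: "(\<Sum>(i, b)\<in>X \<times> ?O. ?\<theta> i b * of_bool (?f y ! i \<and> ?f y ! b)) =
            \<sigma> * (2 * pi * lin X \<gamma> y * (\<Sum>q\<in>R. of_bool (y ! q) / 2 ^ ((q - N) mod \<mu> + 1)))" .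
        have e2: "(\<Sum>q\<in>R. \<sigma> * test_angle N \<mu> 0 q * of_bool (?f y ! q)) =
            (\<Sum>q\<in>R. \<sigma> * test_angle N \<mu> 0 q * of_bool (y ! q))"
          by (intro sum.cong) (auto simp: R f_low)
        have "?\<phi>2 (?f y) * ?\<phi>1 (?f y) = ?\<phi> y"
          unfolding e1 e2 cis_mult unfolding R_def test_phase_split by (simp add: add.commute)
        also have "?\<phi> y = ?\<phi> (take ?N y)"
        proof -
          have "lin X \<gamma> (take ?N y) = lin X \<gamma> y"
            unfolding lin_def by (intro sum.cong) (auto simp: Xi)
          then show ?thesis
            by (intro arg_cong[of _ _ cis] arg_cong[of _ _ "\<lambda>t. \<sigma> * t"] sum.cong) (auto simp: R)
        qed
        finally have \<phi>: "?\<phi>2 (?f y) * ?\<phi>1 (?f y) = ?\<phi> (take ?N y)" .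
        have wz: "with_zeros ?N \<nu> \<chi> y = \<chi> (take ?N y)" for \<chi>
          using y True by (simp add: with_zeros_apply)
        show ?thesis by (rule trans[OF B_y]) (simp only: \<phi> wz diag_def)
      next
        case False
        then show ?thesis using y B_y by (simp only: with_zeros_apply if_False mult_zero_right)
      qed
    qed
  qed
qed

definition round_cost :: "nat \<Rightarrow> nat \<Rightarrow> nat" where
  "round_cost \<mu> c = 2 * test_cost \<mu> c + digits_cost \<mu>"

text \<open>Both test phases come from \<open>implementable_test_phase\<close>, with
  \<open>\<sigma>\<close> = 1 and -1; 255 = 2 * 120 + 15. The claim stays on kets, since in later
  rounds \<open>lin X \<gamma>\<close> need not be integral when the earlier digits are
  wrong.\<close>

lemma implementable_round:
  assumes o: "inj_on out {..<\<mu>}" "out ` {..<\<mu>} \<subseteq> {..<N}"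
    and X: "X \<subseteq> {..<N}" "X \<inter> out ` {..<\<mu>} = {}"
  obtains A where "implementable (N + 2 ^ \<mu> * \<mu>) 255 (round_cost \<mu> (card X)) A"
    "\<And>x k. length x = N \<Longrightarrow> lin X \<gamma> x = real k \<Longrightarrow> A (ket (x @ zeros (2 ^ \<mu> * \<mu>))) =
       ket (flips (out ` {..<\<mu>}) (\<lambda>i _. bit k (inv_into {..<\<mu>} out i)) x @ zeros (2 ^ \<mu> * \<mu>))"
proof -
  let ?L = "2 ^ \<mu> * \<mu>"
  have D: "implementable (N + ?L) 120 (test_cost \<mu> (card X)) (diag (test_phase N \<mu> X \<gamma>))"
    using implementable_test_phase[OF X(1), of \<mu> 1 \<gamma>] by (simp add: test_phase_def[abs_def])
  have D': "implementable (N + ?L) 120 (test_cost \<mu> (card X)) (diag (\<lambda>y. cnj (test_phase N \<mu> X \<gamma> y)))"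
    using implementable_test_phase[OF X(1), of \<mu> "-1" \<gamma>] by (simp add: test_phase_def cis_cnj)
  show ?thesis
    by (rule implementable_digits[OF D D' o X]) (rule that, auto simp: round_cost_def)
qed


section \<open>Counting in eight rounds\<close>

lemma implementable_id: "implementable N 0 0 (\<lambda>\<psi>. \<psi>)"
proof -
  have "implements N a 0 0 (\<lambda>\<psi>. \<psi>) []" for a
    by (simp add: implements_def circuit_on_def circuit_depth_def circuit_size_def run_circuit_def)
  then show ?thesis unfolding implementable_def by blast
qed

text \<open>
  Digit \<open>b\<close> of the weight is kept on qubit \<open>n + msb_pos m b\<close>: the \<open>m\<close> output qubits have the most
  significant digit first, and the surplus digits of the eight rounds lie behind them.
\<close>

definition msb_pos :: "nat \<Rightarrow> nat \<Rightarrow> nat" where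
  "msb_pos m b = (if b < m then m - 1 - b else b)"

lemma msb_pos_msb_pos [simp]: "msb_pos m (msb_pos m b) = b"
  by (auto simp: msb_pos_def)

lemma msb_pos_less: "m \<le> K \<Longrightarrow> b < K \<Longrightarrow> msb_pos m b < K"
  by (auto simp: msb_pos_def)

lemma msb_pos_eq_iff [simp]: "msb_pos m a = msb_pos m b \<longleftrightarrow> a = b"
  by (metis msb_pos_msb_pos)

text \<open>A snapshot between two rounds: digits below \<open>p\<close> are in place, and the
  remaining places are still zero.\<close>

definition count_state :: "nat \<Rightarrow> nat \<Rightarrow> nat \<Rightarrow> bool list \<Rightarrow> bool list" where
  "count_state m K p x =
     x @ map (\<lambda>i. msb_pos m i < p \<and> bit (hamming_weight x) (msb_pos m i)) [0..<K]"

lemma length_count_state [simp]: "length (count_state m K p x) = length x + K"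
  by (simp add: count_state_def)

lemma nth_count_state_low: "i < length x \<Longrightarrow> count_state m K p x ! i = x ! i"
  by (simp add: count_state_def nth_append)

lemma nth_count_state_high: "i < K \<Longrightarrow> count_state m K p x ! (length x + i) \<longleftrightarrow>
   msb_pos m i < p \<and> bit (hamming_weight x) (msb_pos m i)"
  by (simp add: count_state_def nth_append)

lemma hamming_weight_eq_sum: "real (hamming_weight x) = (\<Sum>i<length x. of_bool (x ! i))"
proof -
  have "hamming_weight x = card {i. i < length x \<and> x ! i}"
    by (simp add: hamming_weight_def count_list_eq_length_filter length_filter_conv_card)
  also have "{i. i < length x \<and> x ! i} = {..<length x} \<inter> {i. x ! i}" by auto
  finally show ?thesis by (simp add: Int_def)
qed

lemma hamming_weight_le: "hamming_weight x \<le> length x"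
  by (simp add: hamming_weight_def count_le_length)

lemma round_cost_mono: "c \<le> c' \<Longrightarrow> round_cost \<mu> c \<le> round_cost \<mu> c'"
  unfolding round_cost_def test_cost_def by (intro add_mono mult_le_mono order_refl)

lemma implementable_counting_rounds:
  fixes m r n \<mu> \<rho> :: nat
  assumes m: "m \<le> r * \<mu>" and \<rho>: "\<rho> \<le> r"
  defines "N \<equiv> n + r * \<mu>" and "L \<equiv> 2 ^ \<mu> * \<mu>"
  shows "\<exists>A. implementable (N + L) (255 * \<rho>) (\<rho> * round_cost \<mu> N) A \<and>
    (\<forall>x. length x = n \<longrightarrow> A (ket (count_state m (r * \<mu>) 0 x @ zeros L)) =
       ket (count_state m (r * \<mu>) (\<rho> * \<mu>) x @ zeros L))"
  using \<rho>
proof (induction \<rho>)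
  case 0
  then show ?case using implementable_id[of "N + L"] by auto
next
  case (Suc \<rho>)
  then obtain A where A: "implementable (N + L) (255 * \<rho>) (\<rho> * round_cost \<mu> N) A"
    "\<And>x. length x = n \<Longrightarrow> A (ket (count_state m (r * \<mu>) 0 x @ zeros L)) =
       ket (count_state m (r * \<mu>) (\<rho> * \<mu>) x @ zeros L)"
    by auto
  define p where "p = \<rho> * \<mu>"
  let ?K = "r * \<mu>"
  have pK: "p + \<mu> \<le> ?K" using mult_le_mono1[OF Suc.prems, of \<mu>] by (simp add: p_def add.commute)
  define out where "out b = n + msb_pos m (p + b)" for b
  define X where "X = {..<n} \<union> (\<lambda>b. n + msb_pos m b) ` {..<p}"
  \<comment> \<open>With w the Hamming weight, these weights give (w - w mod 2^p) / 2^p, the natural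
    number w div 2^p; its lowest \<open>\<mu>\<close> digits are the next ones of w. As an
    involution, \<open>msb_pos\<close> also tells which digit a place stores.\<close>
  define \<gamma> where "\<gamma> i = (if i < n then 1 / 2 ^ p else - (2 ^ msb_pos m (i - n)) / 2 ^ p :: real)" for i
  have inj: "inj_on (\<lambda>b. n + msb_pos m b) B" for B
    by (simp add: inj_on_def)
  have oinj: "inj_on out {..<\<mu>}"
    by (simp add: inj_on_def out_def)
  have oN: "out ` {..<\<mu>} \<subseteq> {..<N}"
    using msb_pos_less[OF m] pK by (auto simp: out_def N_def)
  have XN: "X \<subseteq> {..<N}"
    using msb_pos_less[OF m] pK by (auto simp: X_def N_def)
  have XO: "X \<inter> out ` {..<\<mu>} = {}"
    by (auto simp: X_def out_def)
  obtain B where B: "implementable (N + L) 255 (round_cost \<mu> (card X)) B"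
    "\<And>x k. length x = N \<Longrightarrow> lin X \<gamma> x = real k \<Longrightarrow> B (ket (x @ zeros L)) =
       ket (flips (out ` {..<\<mu>}) (\<lambda>i _. bit k (inv_into {..<\<mu>} out i)) x @ zeros L)"
    using implementable_round[OF oinj oN XN XO] unfolding L_def by blast
  \<comment> \<open>The bound by \<open>N\<close> makes the cost independent of the round.\<close>
  have "card X \<le> N" using card_mono[OF _ XN] by simp
  then have B': "implementable (N + L) 255 (round_cost \<mu> N) B"
    using B(1) round_cost_mono by (blast intro: implementable_mono)
  have "B (ket (count_state m ?K p x @ zeros L)) = ket (count_state m ?K (p + \<mu>) x @ zeros L)"
    if x: "length x = n" for x
  proof -
    let ?w = "hamming_weight x"
    let ?s = "count_state m ?K p x"
    let ?k = "?w div 2 ^ p"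
    have "lin X \<gamma> ?s = (\<Sum>i<n. \<gamma> i * of_bool (?s ! i)) +
        (\<Sum>i\<in>(\<lambda>b. n + msb_pos m b) ` {..<p}. \<gamma> i * of_bool (?s ! i))"
      unfolding lin_def X_def by (rule sum.union_disjoint) auto
    also have "(\<Sum>i<n. \<gamma> i * of_bool (?s ! i)) = real ?w / 2 ^ p"
      unfolding hamming_weight_eq_sum sum_divide_distrib x
      by (rule sum.cong) (auto simp: \<gamma>_def nth_count_state_low x)
    also have "(\<Sum>i\<in>(\<lambda>b. n + msb_pos m b) ` {..<p}. \<gamma> i * of_bool (?s ! i)) =
        (\<Sum>b<p. - real (2 ^ b * of_bool (bit ?w b)) / 2 ^ p)"
      unfolding sum.reindex[OF inj] comp_def
    proof (rule sum.cong[OF refl])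
      fix b assume b: "b \<in> {..<p}"
      then have "msb_pos m b < ?K" using msb_pos_less[OF m] pK by auto
      then show "\<gamma> (n + msb_pos m b) * of_bool (?s ! (n + msb_pos m b)) =
          - real (2 ^ b * of_bool (bit ?w b)) / 2 ^ p"
        using nth_count_state_high[of "msb_pos m b" ?K m p x] b by (simp add: \<gamma>_def x)
    qed
    also have "\<dots> = - (real (?w mod 2 ^ p) / 2 ^ p)"
      unfolding sum_bits[symmetric] of_nat_sum sum_divide_distrib sum_negf[symmetric] by simp
    also have "real ?w / 2 ^ p + - (real (?w mod 2 ^ p) / 2 ^ p) = real ?k"
    proof -
      have "real ?w = 2 ^ p * real ?k + real (?w mod 2 ^ p)"
        using arg_cong[OF mult_div_mod_eq[of "2 ^ p" ?w, symmetric], of real]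
        by (simp only: of_nat_add of_nat_mult of_nat_power of_nat_numeral)
      then show ?thesis by (simp add: field_simps)
    qed
    finally have lin: "lin X \<gamma> ?s = real ?k" .
    have "flips (out ` {..<\<mu>}) (\<lambda>i _. bit ?k (inv_into {..<\<mu>} out i)) ?s = count_state m ?K (p + \<mu>) x"
    proof (rule nth_equalityI)
      fix i assume "i < length (flips (out ` {..<\<mu>}) (\<lambda>i _. bit ?k (inv_into {..<\<mu>} out i)) ?s)"
      then have iN: "i < n + ?K" by (simp add: x)
      show "flips (out ` {..<\<mu>}) (\<lambda>i _. bit ?k (inv_into {..<\<mu>} out i)) ?s ! i =
          count_state m ?K (p + \<mu>) x ! i"
      proof (cases "i < n")
        case True
        then have "i \<notin> out ` {..<\<mu>}" by (auto simp: out_def)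
        then show ?thesis using True x iN by (simp add: nth_flips nth_count_state_low)
      next
        case False
        define j where "j = i - n"
        have j: "i = n + j" "j < ?K" using False iN by (auto simp: j_def)
        note s = nth_count_state_high[OF j(2), of m _ x, unfolded x, folded j(1)]
        show ?thesis
        proof (cases "p \<le> msb_pos m j \<and> msb_pos m j < p + \<mu>")
          case True
          define b where "b = msb_pos m j - p"
          have b: "b < \<mu>" "msb_pos m j = p + b" using True by (auto simp: b_def)
          then have ob: "out b = i" by (metis j(1) msb_pos_msb_pos out_def)
          have "inv_into {..<\<mu>} out i = b"
            unfolding ob[symmetric] by (rule inv_into_f_f[OF oinj]) (simp add: b)
          moreover have "i \<in> out ` {..<\<mu>}" using ob b(1) by blast
          moreover have "bit ?k b = bit ?w (p + b)"
            by (simp add: bit_drop_bit_eq add.commute flip: drop_bit_eq_div)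
          ultimately show ?thesis using s x iN b by (simp add: nth_flips)
        next
          case no: False
          have "i \<notin> out ` {..<\<mu>}"
          proof
            assume "i \<in> out ` {..<\<mu>}"
            then obtain b where "b < \<mu>" "j = msb_pos m (p + b)" using j(1) by (auto simp: out_def)
            then show False using no by simp
          qed
          then show ?thesis using s x iN no by (auto simp: nth_flips)
        qed
      qed
    qed (simp add: x)
    then show ?thesis using B(2)[OF _ lin] x by (simp add: N_def)
  qed
  then have "B (A (ket (count_state m ?K 0 x @ zeros L))) = ket (count_state m ?K (Suc \<rho> * \<mu>) x @ zeros L)"
    if "length x = n" for x
    using A(2)[OF that] that by (simp add: p_def add.commute)
  moreover have "implementable (N + L) (255 * Suc \<rho>) (Suc \<rho> * round_cost \<mu> N) (\<lambda>\<psi>. B (A \<psi>))"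
    by (rule implementable_mono[OF implementable_comp[OF A(1) B']]) auto
  ultimately show ?case by blast
qed

section \<open>Width of the count and size of a round\<close>

lemma less_two_power_count_width: "n < 2 ^ count_width n"
proof -
  have "log 2 (real n + 1) \<le> real (count_width n)"
    unfolding count_width_def by (rule real_nat_ceiling_ge)
  then have "real n + 1 \<le> 2 powr real (count_width n)"
    by (simp add: log_le_iff)
  also have "\<dots> = real (2 ^ count_width n)" by (simp add: powr_realpow)
  finally have "real n < real (2 ^ count_width n)" by linarith
  then show ?thesis by (simp only: of_nat_less_iff)
qed

lemma two_power_count_width_le:
  assumes "n \<ge> 1"
  shows "2 ^ count_width n \<le> 2 * n"
proof -
  define m where "m = count_width n"
  have m0: "m \<noteq> 0" using less_two_power_count_width[of n] assms by (cases m) (auto simp: m_def)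
  have "0 \<le> log 2 (real n + 1)" by simp
  then have "real m = of_int \<lceil>log 2 (real n + 1)\<rceil>"
    by (simp add: m_def count_width_def)
  then have "real (m - 1) < log 2 (real n + 1)"
    using m0 ceiling_correct[of "log 2 (real n + 1)"] by (simp add: of_nat_diff)
  then have "2 powr real (m - 1) < real n + 1"
    by (simp add: less_log_iff)
  then have "real (2 ^ (m - 1)) < real (n + 1)" by (simp add: powr_realpow)
  then have "2 ^ (m - 1) < n + 1" by (simp only: of_nat_less_iff)
  then have "2 ^ Suc (m - 1) \<le> 2 * n" by simp
  moreover have "Suc (m - 1) = m" using m0 by simp
  ultimately show ?thesis by (simp only: m_def)
qed


text \<open>66 = 4 + 2 + 10 * (2 + 4) collects the summands after each is bounded by a multiple of
  \<nu>^2 * 2^(2\<nu>).\<close>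

lemma digits_cost_le:
  assumes "1 \<le> \<nu>" shows "digits_cost \<nu> \<le> 66 * (\<nu> ^ 2 * (2 ^ \<nu>) ^ 2)"
proof -
  let ?P = "2 ^ \<nu> :: nat"
  let ?X = "(?P * ?P) * (\<nu> * \<nu>)"
  have P: "1 \<le> ?P" by simp
  have "?P * \<nu> \<le> ?X" using assms P by (intro mult_le_mono) auto
  moreover have "1 * \<nu> \<le> ?X" using assms P by (intro mult_le_mono) auto
  moreover have "(?P * ?P) * \<nu> \<le> ?X" using assms by (intro mult_le_mono2) auto
  moreover have "\<nu> * (?P * (2 ^ (\<nu> + 1) * (\<nu> + 2))) = 2 * ?X + 4 * ((?P * ?P) * \<nu>)"
    by (simp add: algebra_simps)
  ultimately have "digits_cost \<nu> \<le> 66 * ?X"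
    unfolding digits_cost_def by linarith
  then show ?thesis by (simp add: power2_eq_square mult.commute)
qed

text \<open>The decisive term is \<open>digits_cost (3 * \<mu>)\<close>, of order \<mu>^2 *
  2^(6\<mu>), and \<mu> <= 2^\<mu> bounds it by a multiple of 2^(8\<mu>). The constants are 594 = 66
  * 9, 1554 = 2 * (360 + 120) + 594, 2 * (2 * 1554 + 40) + 66 <= 6400 and 720 = 2 * 120 * 3.\<close>

lemma round_cost_le:
  assumes "1 \<le> \<mu>"
  shows "round_cost \<mu> c \<le> 6400 * (2 ^ \<mu>) ^ 8 + 720 * (c * \<mu>)"
proof -
  define Q :: nat where "Q = 2 ^ \<mu>"
  have Q: "1 \<le> Q" "\<mu> \<le> Q" by (simp_all add: Q_def less_imp_le)
  have P: "(2::nat) ^ (3 * \<mu>) = Q ^ 3" by (simp add: Q_def mult.commute flip: power_mult)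
  have pw: "Q ^ i * \<mu> ^ j \<le> Q ^ 8" if "i + j \<le> 8" for i j
  proof -
    have "Q ^ i * \<mu> ^ j \<le> Q ^ i * Q ^ j" using Q by (intro mult_le_mono2 power_mono) auto
    also have "\<dots> \<le> Q ^ 8" using Q that by (simp flip: power_add add: power_increasing)
    finally show ?thesis .
  qed
  have d1: "digits_cost \<mu> \<le> 66 * Q ^ 8"
    using digits_cost_le[OF assms] pw[of 2 2] by (simp add: Q_def mult.commute)
  have d3: "digits_cost (3 * \<mu>) \<le> 594 * Q ^ 8"
  proof -
    have "digits_cost (3 * \<mu>) \<le> 66 * ((3 * \<mu>) ^ 2 * (Q ^ 3) ^ 2)"
      using digits_cost_le[of "3 * \<mu>"] assms P by simp
    also have "\<dots> = 594 * (Q ^ 6 * \<mu> ^ 2)" by (simp add: power_mult_distrib flip: power_mult)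
    also have "\<dots> \<le> 594 * Q ^ 8" using pw[of 6 2] by simp
    finally show ?thesis .
  qed
  have s: "sum_cost (3 * \<mu>) (Q * \<mu>) \<le> 1554 * Q ^ 8"
  proof -
    have e1: "Q ^ 3 * (3 * \<mu>) * (Q * \<mu>) = 3 * (Q ^ 4 * \<mu> ^ 2)"
      by (simp add: power2_eq_square power3_eq_cube power4_eq_xxxx mult_ac)
    have e2: "Q ^ 3 * (3 * \<mu>) = 3 * (Q ^ 3 * \<mu>)" by simp
    have "Q ^ 4 * \<mu> ^ 2 \<le> Q ^ 8" "Q ^ 3 * \<mu> \<le> Q ^ 8" using pw[of 4 2] pw[of 3 1] by simp_all
    moreover have "2 * (120 * (3 * a) + 40 * (3 * b)) + d \<le> 1554 * q"
      if "a \<le> q" "b \<le> q" "d \<le> 594 * q" for a b d q :: nat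
      using that by simp
    ultimately show ?thesis
      unfolding sum_cost_def P e1 unfolding e2 using d3 by blast
  qed
  have "Q * \<mu> \<le> Q ^ 8" using pw[of 1 1] by simp
  then show ?thesis
    unfolding round_cost_def test_cost_def Q_def[symmetric] using s d1 by simp
qed

section \<open>The counting operator as a restricted involution\<close>

text \<open>
  The counting operator is the restriction of this involution to the states whose last \<open>m\<close> qubits
  are zero.
\<close>

definition add_count :: "nat \<Rightarrow> nat \<Rightarrow> bool list \<Rightarrow> bool list" where
  "add_count n m = flips {n..<n + m} (\<lambda>i y. bit (hamming_weight (take n y)) (n + m - 1 - i))"

lemma length_add_count [simp]: "length (add_count n m y) = length y"
  by (simp add: add_count_def)

lemma add_count_add_count:
  assumes "length y = n + m" shows "add_count n m (add_count n m y) = y"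
  unfolding add_count_def
proof (rule flips_flips)
  fix i
  have "take n (flips {n..<n + m} g y) = take n y" for g
    by (rule nth_equalityI) (use assms in \<open>auto simp: nth_flips\<close>)
  then show "bit (hamming_weight (take n (flips {n..<n + m}
        (\<lambda>i y. bit (hamming_weight (take n y)) (n + m - 1 - i)) y))) (n + m - 1 - i) =
      bit (hamming_weight (take n y)) (n + m - 1 - i)" by simp
qed

lemma length_binary [simp]: "length (binary m w) = m"
  by (simp add: binary_def)

lemma nth_binary: "i < m \<Longrightarrow> binary m w ! i \<longleftrightarrow> bit w (m - 1 - i)"
  by (simp add: binary_def rev_nth)

lemma add_count_zeros:
  assumes "length x = n"
  shows "add_count n m (x @ zeros m) = x @ binary m (hamming_weight x)"
proof (rule nth_equalityI)
  fix i assume "i < length (add_count n m (x @ zeros m))"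
  then have i: "i < n + m" using assms by simp
  show "add_count n m (x @ zeros m) ! i = (x @ binary m (hamming_weight x)) ! i"
  proof (cases "i < n")
    case True
    then show ?thesis using i assms by (simp add: add_count_def nth_flips nth_append)
  next
    case False
    then have "m - 1 - (i - n) = n + m - 1 - i" using i by simp
    then show ?thesis
      using i assms False by (simp add: add_count_def nth_flips nth_append nth_binary del: diff_diff_left)
  qed
qed (use assms in simp)

lemma count_state_0: "count_state m K 0 x = x @ zeros K"
  by (simp add: count_state_def map_replicate_const)

lemma count_state_full:
  assumes "m \<le> K" "hamming_weight x < 2 ^ m"
  shows "count_state m K K x = x @ binary m (hamming_weight x) @ zeros (K - m)"
proof (rule nth_equalityI)
  fix i assume "i < length (count_state m K K x)"
  then have i: "i < length x + K" by simp
  have hi: "\<not> bit (hamming_weight x) b" if "m \<le> b" for b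
    using bit_take_bit_iff[of m "hamming_weight x" b] assms(2) that
    by (simp add: take_bit_nat_eq_self)
  show "count_state m K K x ! i = (x @ binary m (hamming_weight x) @ zeros (K - m)) ! i"
  proof (cases "i < length x")
    case True
    then show ?thesis by (simp add: nth_count_state_low nth_append)
  next
    case False
    define j where "j = i - length x"
    have j: "i = length x + j" "j < K" using i False by (auto simp: j_def)
    have "msb_pos m j < K" using msb_pos_less[OF assms(1) j(2)] .
    then show ?thesis
      using j nth_count_state_high[OF j(2), of m K x] hi[of j]
      by (auto simp: nth_append nth_binary msb_pos_def)
  qed
qed (use assms in simp)

text \<open>Linear combinations preserve a condition on the support, so it cuts out a subspace; the
  norm is unchanged because \<open>f\<close> permutes the strings of length
  \<open>k\<close>.\<close>

lemma quantum_operator_involution: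
  assumes len: "\<And>y. length (f y) = length y" and ff: "\<And>y. length y = k \<Longrightarrow> f (f y) = y"
  shows "quantum_operator k {\<psi> \<in> qspace k. \<forall>z. \<psi> z \<noteq> 0 \<longrightarrow> P z} (\<lambda>\<psi> y. \<psi> (f y))"
proof -
  have norm: "qnorm k (\<lambda>y. \<psi> (f y)) = qnorm k \<psi>" for \<psi>
    unfolding qnorm_def L2_set_def
    by (intro arg_cong[of _ _ sqrt] sum.reindex_bij_witness[of _ f f])
      (auto simp: bitstrings_def len ff)
  show ?thesis
    unfolding quantum_operator_def
  proof (intro conjI ballI allI)
    fix \<phi> \<psi> :: qvec and \<alpha> \<beta> :: complex
    assume \<phi>: "\<phi> \<in> {\<psi> \<in> qspace k. \<forall>z. \<psi> z \<noteq> 0 \<longrightarrow> P z}"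
      and \<psi>: "\<psi> \<in> {\<psi> \<in> qspace k. \<forall>z. \<psi> z \<noteq> 0 \<longrightarrow> P z}"
    have "P z" if "\<alpha> * \<phi> z + \<beta> * \<psi> z \<noteq> 0" for z
      using that \<phi> \<psi> by (cases "\<phi> z = 0") auto
    moreover have "(\<lambda>x. \<alpha> * \<phi> x + \<beta> * \<psi> x) \<in> qspace k"
      using \<phi> \<psi> by (auto intro!: qspaceI simp: qspaceD)
    ultimately show "(\<lambda>x. \<alpha> * \<phi> x + \<beta> * \<psi> x) \<in> {\<psi> \<in> qspace k. \<forall>z. \<psi> z \<noteq> 0 \<longrightarrow> P z}"
      by blast
  next
    fix \<psi> assume "\<psi> \<in> {\<psi> \<in> qspace k. \<forall>z. \<psi> z \<noteq> 0 \<longrightarrow> P z}"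
    then show "(\<lambda>y. \<psi> (f y)) \<in> qspace k" using pull_qspace[OF _ len] by blast
  qed (auto simp: norm qspace_def)
qed

text \<open>Eight blocks of this width cover all digits, while 2^(8\<mu>) exceeds 2^m, for m the
  count width, by a factor of at most 256 and so stays linear in n. Adding 1 also rules out width
  0.\<close>

definition digit_width :: "nat \<Rightarrow> nat" where
  "digit_width n = count_width n div 8 + 1"

lemma counting_circuit:
  assumes "n \<ge> 1"
  shows "\<exists>a C. circuit_on (n + count_width n + a) C \<and> circuit_depth C \<le> 2040 \<and>
    circuit_size C \<le> 8 * round_cost (digit_width n) (n + 8 * digit_width n) \<and>
    (\<exists>D V. counting_operator n D V \<and> approximates (n + count_width n) a C D V 0)"
proof -
  define m where "m = count_width n"
  define \<mu> where "\<mu> = digit_width n"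
  define K where "K = 8 * \<mu>"
  define L where "L = 2 ^ \<mu> * \<mu>"
  \<comment> \<open>Behind the \<open>m\<close> output qubits lie \<open>K - m\<close> surplus
    digits, which end in zero because the weight is below 2^m, and \<open>L\<close> test qubits. All
    of them count as ancillas.\<close>
  define e where "e = K - m + L"
  have mK: "m \<le> K"
    using div_mult_mod_eq[of m 8] by (simp add: K_def \<mu>_def digit_width_def m_def)
  have e: "n + K + L = n + m + e" using mK by (simp add: e_def)
  \<comment> \<open>2040 = 8 * 255.\<close>
  have "\<exists>A. implementable (n + m + e) 2040 (8 * round_cost \<mu> (n + K)) A \<and>
      (\<forall>x. length x = n \<longrightarrow> A (ket (count_state m K 0 x @ zeros L)) =
         ket (count_state m K K x @ zeros L))"
    using implementable_counting_rounds[of m 8 \<mu> 8 n, folded K_def L_def, unfolded e] mK by simp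
  then obtain A where A: "implementable (n + m + e) 2040 (8 * round_cost \<mu> (n + K)) A"
    "\<And>x. length x = n \<Longrightarrow> A (ket (count_state m K 0 x @ zeros L)) =
       ket (count_state m K K x @ zeros L)"
    by blast
  let ?f = "add_count n m"
  \<comment> \<open>The rounds are controlled only when they start from zero output qubits, so the
    domain is restricted to these states.\<close>
  define D where "D = {\<psi> \<in> qspace (n + m). \<forall>z. \<psi> z \<noteq> 0 \<longrightarrow> drop n z = zeros m}"
  define V :: "qvec \<Rightarrow> qvec" where "V \<psi> = (\<lambda>y. \<psi> (?f y))" for \<psi>
  have ff: "?f (?f y) = y" if "length y = n + m" for y
    by (rule add_count_add_count[OF that])
  have V_ket: "V (ket z) = ket (?f z)" if z: "length z = n + m" for z
  proof
    fix y
    have "?f y = z \<longleftrightarrow> y = ?f z"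
    proof
      assume "?f y = z"
      moreover from this have "length y = n + m" using z by auto
      ultimately show "y = ?f z" using ff by metis
    qed (use ff[OF z] in simp)
    then show "V (ket z) y = ket (?f z) y" by (simp add: V_def ket_def)
  qed
  have "counting_operator n D V"
    unfolding counting_operator_def m_def[symmetric]
  proof (intro conjI ballI)
    show "quantum_operator (n + m) D V"
      unfolding D_def V_def[abs_def] by (rule quantum_operator_involution) (simp_all add: ff)
    fix x assume "x \<in> bitstrings n"
    then have x: "length x = n" by (simp add: bitstrings_def)
    show "ket (x @ zeros m) \<in> D"
      using x by (auto simp: D_def ket_qspace) (simp add: ket_def split: if_splits)
    show "V (ket (x @ zeros m)) = ket (x @ binary m (hamming_weight x))"
      using V_ket[of "x @ zeros m"] x by (simp add: add_count_zeros)
  qed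
  moreover have A_V: "A (with_zeros (n + m) e \<psi>) = with_zeros (n + m) e (V \<psi>)" if \<psi>: "\<psi> \<in> D" for \<psi>
  proof (rule qspace_eqI)
    have q: "\<psi> \<in> qspace (n + m)" using \<psi> by (simp add: D_def)
    show "A (with_zeros (n + m) e \<psi>) \<in> qspace (n + m + e)"
      by (rule implementable_qspace[OF A(1) with_zeros_qspace[OF q]])
    show "with_zeros (n + m) e (V \<psi>) \<in> qspace (n + m + e)"
      unfolding V_def by (rule with_zeros_qspace[OF pull_qspace[OF q]]) simp
    fix y :: "bool list" assume y: "length y = n + m + e"
    \<comment> \<open>Away from the strings \<open>x @ zeros m\<close> the amplitude of
      \<open>\<psi>\<close> is zero, so unknown values of \<open>A\<close> do not enter.\<close>
    have *: "\<psi> z * A (ket (z @ zeros e)) y = \<psi> z * ket (?f z @ zeros e) y"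
      if z: "z \<in> bitstrings (n + m)" for z
    proof (cases "\<psi> z = 0")
      case False
      define x where "x = take n z"
      have x: "length x = n" using z by (simp add: x_def bitstrings_def)
      have zx: "z = x @ zeros m"
      proof -
        have "drop n z = zeros m" using False \<psi> by (simp add: D_def)
        then show ?thesis using append_take_drop_id[of n z] by (simp only: x_def)
      qed
      have "hamming_weight x < 2 ^ m"
        using hamming_weight_le[of x] x less_two_power_count_width[of n] by (simp add: m_def)
      then have full: "count_state m K K x @ zeros L = ?f z @ zeros e"
        by (simp add: count_state_full[OF mK] zx add_count_zeros[OF x] e_def replicate_add)
      have "z @ zeros e = count_state m K 0 x @ zeros L"
        using mK by (simp add: zx count_state_0 e_def flip: replicate_add)
      then show ?thesis using A(2)[OF x] full by simp
    qed simp
    have "A (with_zeros (n + m) e \<psi>) y = (\<Sum>z\<in>bitstrings (n + m). \<psi> z * ket (?f z @ zeros e) y)"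
      unfolding implementable_with_zeros_linear[OF A(1) q] by (rule sum.cong[OF refl]) (rule *)
    also have "\<dots> = with_zeros (n + m) e (V \<psi>) y"
      unfolding V_def by (rule sum_ket_involution[OF length_add_count ff y])
    finally show "A (with_zeros (n + m) e \<psi>) y = with_zeros (n + m) e (V \<psi>) y" .
  qed
  moreover obtain b C where C: "implements (n + m + e) b 2040 (8 * round_cost \<mu> (n + K)) A C"
    using A(1) unfolding implementable_def by blast
  moreover have "approximates (n + m) (e + b) C D V 0"
    unfolding approximates_def
  proof (intro ballI impI)
    fix \<psi> assume \<psi>: "\<psi> \<in> D"
    then have q: "\<psi> \<in> qspace (n + m)" by (simp add: D_def)
    have qV: "V \<psi> \<in> qspace (n + m)" unfolding V_def by (rule pull_qspace[OF q]) simp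
    have "run_circuit (n + m + e + b) C (with_zeros (n + m + e) b (with_zeros (n + m) e \<psi>)) =
        with_zeros (n + m + e) b (with_zeros (n + m) e (V \<psi>))"
      using C with_zeros_qspace[OF q, of e] A_V[OF \<psi>] by (simp add: implements_def)
    then have "run_circuit (n + m + (e + b)) C (with_zeros (n + m) (e + b) \<psi>) =
        with_zeros (n + m) (e + b) (V \<psi>)"
      unfolding with_zeros_add[OF q] with_zeros_add[OF qV] by (simp only: add.assoc)
    then show "qnorm (n + m + (e + b)) (\<lambda>z. run_circuit (n + m + (e + b)) C (with_zeros (n + m) (e + b) \<psi>) z
        - with_zeros (n + m) (e + b) (V \<psi>) z) \<le> 0"
      by (simp add: qnorm_def L2_set_def)
  qed
  moreover have "circuit_on (n + m + (e + b)) C" "circuit_depth C \<le> 2040"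
      "circuit_size C \<le> 8 * round_cost \<mu> (n + K)"
    using C by (simp_all add: implements_def add.assoc)
  ultimately show ?thesis
    unfolding m_def \<mu>_def K_def by blast
qed

section \<open>Total size and the circuit family\<close>

lemma counting_circuit_size_bound:
  assumes "n \<ge> 2"
  shows "real (8 * round_cost (digit_width n) (n + 8 * digit_width n)) \<le> 10 ^ 9 * (real n * log 2 (real n))"
proof -
  define m where "m = count_width n"
  define \<mu> where "\<mu> = digit_width n"
  have n1: "1 \<le> n" using assms by simp
  have \<mu>: "1 \<le> \<mu>" by (simp add: \<mu>_def digit_width_def)
  have m_le: "2 ^ m \<le> 2 * n" unfolding m_def by (rule two_power_count_width_le[OF n1])
  have "8 * \<mu> \<le> m + 8" by (simp add: \<mu>_def digit_width_def m_def)
  \<comment> \<open>Together with 2^m <= 2n this gives 2^(8\<mu>) <= 256 * 2n.\<close>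
  then have "(2::nat) ^ (\<mu> * 8) \<le> 2 ^ (m + 8)" by (intro power_increasing) auto
  also have "\<dots> \<le> 512 * n" using m_le by (simp add: power_add)
  finally have Q8: "(2 ^ \<mu>) ^ 8 \<le> 512 * n" by (simp add: power_mult)
  have "\<mu> * \<mu> \<le> (2 ^ \<mu>) ^ 8"
  proof -
    have "\<mu> * \<mu> \<le> 2 ^ \<mu> * 2 ^ \<mu>" by (intro mult_le_mono) (simp_all add: less_imp_le)
    also have "\<dots> = (2 ^ \<mu>) ^ 2" by (simp add: power2_eq_square)
    also have "\<dots> \<le> (2 ^ \<mu>) ^ 8" by (rule power_increasing) auto
    finally show ?thesis .
  qed
  then have \<mu>2: "\<mu> * \<mu> \<le> 512 * n" using Q8 by simp
  have n\<mu>: "n \<le> n * \<mu>" using \<mu> by simp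
  have "round_cost \<mu> (n + 8 * \<mu>) \<le> 6400 * (2 ^ \<mu>) ^ 8 + 720 * ((n + 8 * \<mu>) * \<mu>)"
    by (rule round_cost_le[OF \<mu>])
  also have "(n + 8 * \<mu>) * \<mu> = n * \<mu> + 8 * (\<mu> * \<mu>)" by (simp add: algebra_simps)
  finally have cost: "round_cost \<mu> (n + 8 * \<mu>) \<le> 6400 * (2 ^ \<mu>) ^ 8 + 720 * (n * \<mu> + 8 * (\<mu> * \<mu>))" .
  \<comment> \<open>8 * (6400 * 512 + 720 * (1 + 8 * 512)) is below 60000000.\<close>
  have *: "8 * k \<le> 60000000 * p"
    if "k \<le> 6400 * q + 720 * (p + 8 * m)" "q \<le> 512 * n" "m \<le> 512 * n" "n \<le> p"
    for k q m p :: nat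
    using that by simp
  have "real (8 * round_cost \<mu> (n + 8 * \<mu>)) \<le> real (60000000 * (n * \<mu>))"
    unfolding of_nat_le_iff by (rule *[OF cost Q8 \<mu>2 n\<mu>])
  also have "\<dots> = 60000000 * (real n * real \<mu>)" by simp
  finally have 1: "real (8 * round_cost \<mu> (n + 8 * \<mu>)) \<le> 60000000 * (real n * real \<mu>)" .
  have "real (2 ^ m) \<le> real (2 * n)" unfolding of_nat_le_iff by (rule m_le)
  then have "2 ^ m \<le> 2 * real n" by simp
  then have "log 2 (2 ^ m) \<le> log 2 (2 * real n)"
    using assms by (subst log_le_cancel_iff) simp_all
  then have "real m \<le> 1 + log 2 (real n)" using assms by (simp add: log_mult log_nat_power)
  moreover have "1 \<le> log 2 (real n)" using assms by (simp add: le_log_iff)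
  moreover have "\<mu> \<le> m + 1" by (simp add: \<mu>_def digit_width_def m_def)
  then have "real \<mu> \<le> real m + 1" by linarith
  \<comment> \<open>\<mu> <= m + 1 <= 2 + log n, and 2 <= 2 log n for n >= 2.\<close>
  ultimately have "real \<mu> \<le> 3 * log 2 (real n)" by linarith
  then have "60000000 * (real n * real \<mu>) \<le> 60000000 * (real n * (3 * log 2 (real n)))"
    by (intro mult_left_mono) auto
  also have "\<dots> = 180000000 * (real n * log 2 (real n))" by simp
  also have "\<dots> \<le> 10 ^ 9 * (real n * log 2 (real n))"
    using \<open>1 \<le> log 2 (real n)\<close> by (intro mult_right_mono) auto
  finally show ?thesis using 1 unfolding \<mu>_def by (rule order_trans[rotated])
qed

theorem theorem26:
  fixes c :: real
  assumes "c > 0"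
  shows "\<exists>(a :: nat \<Rightarrow> nat) (C :: nat \<Rightarrow> circuit) (d :: nat).
    (\<forall>n\<ge>1. circuit_on (n + count_width n + a n) (C n) \<and>
            circuit_depth (C n) \<le> d \<and>
            (\<exists>D V. counting_operator n D V \<and>
                   approximates (n + count_width n) (a n) (C n) D V (real n powr (- c)))) \<and>
    (\<lambda>n. real (circuit_size (C n))) \<in> O(\<lambda>n. real n * log 2 (real n))"
proof -
  have "\<forall>n. \<exists>a C. n \<ge> 1 \<longrightarrow> circuit_on (n + count_width n + a) C \<and> circuit_depth C \<le> 2040 \<and>
      circuit_size C \<le> 8 * round_cost (digit_width n) (n + 8 * digit_width n) \<and>
      (\<exists>D V. counting_operator n D V \<and> approximates (n + count_width n) a C D V 0)"
    using counting_circuit by blast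
  then obtain a C where C: "\<And>n. n \<ge> 1 \<Longrightarrow>
      circuit_on (n + count_width n + a n) (C n) \<and> circuit_depth (C n) \<le> 2040 \<and>
      circuit_size (C n) \<le> 8 * round_cost (digit_width n) (n + 8 * digit_width n) \<and>
      (\<exists>D V. counting_operator n D V \<and> approximates (n + count_width n) (a n) (C n) D V 0)"
    by metis
  \<comment> \<open>Error 0 is below n^(-c) for every \<open>c\<close>, so the constants of this
    family do not depend on \<open>c\<close>.\<close>
  have "approximates k b E D V (real n powr (- c))" if "approximates k b E D V 0" for k b E D V n
    using that powr_ge_zero[of "real n" "- c"] unfolding approximates_def by (meson order_trans)
  then have "\<forall>n\<ge>1. circuit_on (n + count_width n + a n) (C n) \<and> circuit_depth (C n) \<le> 2040 \<and>
      (\<exists>D V. counting_operator n D V \<and>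
         approximates (n + count_width n) (a n) (C n) D V (real n powr (- c)))"
    using C by blast
  moreover have "(\<lambda>n. real (circuit_size (C n))) \<in> O(\<lambda>n. real n * log 2 (real n))"
  proof (rule bigoI)
    show "\<forall>\<^sub>F n in sequentially. norm (real (circuit_size (C n))) \<le> 10 ^ 9 * norm (real n * log 2 (real n))"
      unfolding eventually_sequentially
    proof (intro exI allI impI)
      \<comment> \<open>The bound n log n is 0 at n = 1, so the estimate starts at 2.\<close>
      fix n :: nat assume n: "2 \<le> n"
      have "real (circuit_size (C n)) \<le> real (8 * round_cost (digit_width n) (n + 8 * digit_width n))"
        using C[of n] n by (simp only: of_nat_le_iff)
      also note counting_circuit_size_bound[OF n]
      also have "real n * log 2 (real n) \<le> norm (real n * log 2 (real n))" by simp
      finally show "norm (real (circuit_size (C n))) \<le> 10 ^ 9 * norm (real n * log 2 (real n))" by simp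
    qed
  qed
  ultimately show ?thesis by blast
qed

end
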